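(* Let $m \geq 1$ be a fixed integer. For each integer $n \geq 1$, let $\mathbf{W}_1^{(n)}, \dots, \mathbf{W}_m^{(n)} \in \mathbb{R}^{n \times n}$ be independent random matrices, each with i.i.d. real Gaussian entries of mean $0$ and standard deviation $n^{-1/2}$ (i.e. variance $1/n$), where the matrices for all $n$ are defined on a common probability space (no assumption is made on the joint distribution across different values of $n$). Then, almost surely, $$ s_1^2\big(\mathbf{W}_1^{(n)} \mathbf{W}_2^{(n)} \cdots \mathbf{W}_m^{(n)}\big) \longrightarrow u_m := \frac{(m+1)^{m+1}}{m^m} \quad \text{as } n \to \infty. $$
   Context: For a real $n \times n$ matrix $A$, $s_1(A) \geq s_2(A) \geq \dots \geq s_n(A) \geq 0$ denote its singular values, so $s_1(A)$ is the largest singular value and $s_1^2(A) = (s_1(A))^2$. *)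

theory Defs
  imports "HOL-Probability.Probability" "Jordan_Normal_Form.Char_Poly"
begin

text \<open>The singular values of a square real matrix \<open>A\<close> are the square roots of the eigenvalues of
  \<open>A\<^sup>T A\<close>. They are listed in decreasing order and repeated according to multiplicity; as \<open>A\<^sup>T A\<close> is
  symmetric and positive semidefinite, the characteristic polynomial splits over the reals and
  an \<open>n \<times> n\<close> matrix gets exactly \<open>n\<close> of them.\<close>

definition singular_values :: "real mat \<Rightarrow> real list" where
  "singular_values A =
     rev (sorted_list_of_multiset (image_mset sqrt (proots (char_poly (transpose_mat A * A)))))"

text \<open>Singular values are counted from 1, so \<open>singular_value 1 A\<close> is the largest one.\<close>

definition singular_value :: "nat \<Rightarrow> real mat \<Rightarrow> real" where
  "singular_value k A = singular_values A ! (k - 1)"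

text \<open>The Borel sigma-algebra on the \<open>n \<times> n\<close> real matrices, transported from the product
  sigma-algebra on the families of entries.\<close>

definition borel_mat :: "nat \<Rightarrow> real mat measure" where
  "borel_mat n =
     vimage_algebra (carrier_mat n n) (\<lambda>A. \<lambda>p\<in>{..<n} \<times> {..<n}. A $$ p)
       (PiM ({..<n} \<times> {..<n}) (\<lambda>_. borel))"

definition iid_gaussian_mat :: "'w measure \<Rightarrow> nat \<Rightarrow> real \<Rightarrow> ('w \<Rightarrow> real mat) \<Rightarrow> bool" where
  "iid_gaussian_mat M n \<sigma> X \<longleftrightarrow>
     X \<in> measurable M (borel_mat n) \<and>
     prob_space.indep_vars M (\<lambda>_. borel) (\<lambda>p \<omega>. X \<omega> $$ p) ({..<n} \<times> {..<n}) \<and>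
     (\<forall>p \<in> {..<n} \<times> {..<n}. distributed M lborel (\<lambda>\<omega>. X \<omega> $$ p) (normal_density 0 \<sigma>))"

text \<open>The ordered product \<open>X 1 * X 2 * \<dots> * X m\<close> of \<open>n \<times> n\<close> matrices.\<close>

definition mat_product :: "nat \<Rightarrow> nat \<Rightarrow> (nat \<Rightarrow> real mat) \<Rightarrow> real mat" where
  "mat_product n m X = foldr (\<lambda>k P. X k * P) [1..<Suc m] (1\<^sub>m n)"

definition u_limit :: "nat \<Rightarrow> real" where
  "u_limit m = real (m + 1) ^ (m + 1) / real m ^ m"

end

theory Submission
  imports Defs "HOL-Real_Asymp.Real_Asymp" "Jordan_Normal_Form.Schur_Decomposition"
begin

text \<open>Let \<open>P = W\<^sub>1 \<dots> W\<^sub>m\<close>, let \<open>p\<^sub>j = tr ((P\<^sup>T P)\<^sup>j)\<close>, and let \<open>S\<close> be the square of the largest singular value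
  of \<open>P\<close>, so that \<open>S\<^sup>j \<le> p\<^sub>j \<le> n S\<^sup>j\<close>. Everything rests on Gaussian integration by parts for polynomials with
  nonnegative coefficients in the entries. Such polynomials are positively correlated.

  Lower bound: the loop equations give \<open>E p\<^sub>i \<ge> n a\<^sub>i\<close> for a sequence \<open>a\<close> that dominates its own shifted
  \<open>(m+1)\<close>-fold convolution, and \<open>Var p\<^sub>i = O(1)\<close>. The generating function \<open>G\<close> of \<open>a\<close> then satisfies
  \<open>G \<ge> 1 + z G\<^bsup>m+1\<^esup>\<close> wherever it converges, which is impossible for \<open>z > 1/u\<^sub>m\<close>. So \<open>a\<^sub>i > y\<^sup>i\<close> for some \<open>i\<close>
  whenever \<open>y < u\<^sub>m\<close>, and Chebyshev's inequality applies.

  Upper bound: let \<open>g\<close> be a further independent Gaussian vector and \<open>q = \<bar>P g\<bar>\<^sup>2\<close>. The moments of \<open>q\<close>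
  are explicit, \<open>E q\<^sup>k = (\<Prod>l<k. (n + 2l)/n)\<^bsup>m+1\<^esup>\<close>. Integrating by parts in \<open>g\<close> and using positive
  correlation, \<open>E q\<^sup>k\<close> dominates an explicit multiple of \<open>E p\<^sub>j E q\<^bsup>k-j\<^esup>\<close>. For \<open>k \<approx> n/(2m)\<close> and
  \<open>j \<approx> \<surd>n\<close> this gives \<open>E p\<^sub>j \<le> 2 k (u\<^sub>m + o(1))\<^sup>j\<close>, because \<open>(1 + \<beta>)\<^bsup>m+1\<^esup>/\<beta>\<close> equals \<open>u\<^sub>m\<close> at its minimum
  \<open>\<beta> = 1/m\<close>. Markov's inequality concludes.\<close>

section \<open>Gaussian polynomials with nonnegative coefficients\<close>

inductive pos_poly :: "'v set \<Rightarrow> (('v \<Rightarrow> real) \<Rightarrow> real) \<Rightarrow> bool" for V where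
  const: "0 \<le> c \<Longrightarrow> pos_poly V (\<lambda>x. c)"
| var: "v \<in> V \<Longrightarrow> pos_poly V (\<lambda>x. x v)"
| add: "pos_poly V f \<Longrightarrow> pos_poly V g \<Longrightarrow> pos_poly V (\<lambda>x. f x + g x)"
| mult: "pos_poly V f \<Longrightarrow> pos_poly V g \<Longrightarrow> pos_poly V (\<lambda>x. f x * g x)"

lemma pos_poly_sum:
  "(\<And>i. i \<in> A \<Longrightarrow> pos_poly V (f i)) \<Longrightarrow> pos_poly V (\<lambda>x. \<Sum>i\<in>A. f i x)"
  by (induction A rule: infinite_finite_induct) (auto intro: pos_poly.intros)

lemma pos_poly_sum_list:
  "(\<And>i. i \<in> set is \<Longrightarrow> pos_poly V (f i)) \<Longrightarrow> pos_poly V (\<lambda>x. \<Sum>i\<leftarrow>is. f i x)"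
  by (induction "is") (auto intro: pos_poly.intros)

lemma pos_poly_power: "pos_poly V f \<Longrightarrow> pos_poly V (\<lambda>x. f x ^ k)"
  by (induction k) (auto intro: pos_poly.intros)

lemma pos_poly_mono: "pos_poly V f \<Longrightarrow> V \<subseteq> V' \<Longrightarrow> pos_poly V' f"
  by (induction rule: pos_poly.induct) (auto intro: pos_poly.intros)

section \<open>Monomials and the normal form of nonnegative polynomials\<close>

definition mon :: "'v multiset \<Rightarrow> ('v \<Rightarrow> real) \<Rightarrow> real" where
  "mon \<mu> x = (\<Prod>v\<in>#\<mu>. x v)"

lemma mon_simps [simp]:
  "mon {#} x = 1" "mon (add_mset v \<mu>) x = x v * mon \<mu> x" "mon (\<mu> + \<nu>) x = mon \<mu> x * mon \<nu> x"
  by (simp_all add: mon_def)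

lemma mon_add_mset_fun: "mon (add_mset v \<mu>) = (\<lambda>x. x v * mon \<mu> x)"
  and mon_union_fun: "mon (\<mu> + \<nu>) = (\<lambda>x. mon \<mu> x * mon \<nu> x)"
  by auto

lemma pos_poly_mon: "set_mset \<mu> \<subseteq> V \<Longrightarrow> pos_poly V (mon \<mu>)"
proof (induction \<mu>)
  case empty
  then show ?case using pos_poly.const[of 1 V] by (simp add: mon_def[abs_def])
next
  case (add v \<mu>)
  have "mon (add_mset v \<mu>) = (\<lambda>x. x v * mon \<mu> x)" by auto
  then show ?case using add by (auto intro: pos_poly.intros)
qed

text \<open>Monomials are multisets, so the product of two normal forms is the list of all pairwise
  products with the multisets added. A list may repeat monomials, which spares collecting like
  terms.\<close>

lemma pos_poly_as_sum_mon:
  assumes "pos_poly V f"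
  shows "\<exists>cs. (\<forall>(c, \<mu>)\<in>set cs. 0 \<le> c \<and> set_mset \<mu> \<subseteq> V) \<and> f = (\<lambda>x. \<Sum>(c, \<mu>)\<leftarrow>cs. c * mon \<mu> x)"
  using assms
proof induction
  case (const c)
  then show ?case by (intro exI[of _ "[(c, {#})]"]) auto
next
  case (var v)
  then show ?case by (intro exI[of _ "[(1, {#v#})]"]) auto
next
  case (add f g)
  then obtain cs ds where
    "\<forall>(c, \<mu>)\<in>set cs. 0 \<le> c \<and> set_mset \<mu> \<subseteq> V" "f = (\<lambda>x. \<Sum>(c, \<mu>)\<leftarrow>cs. c * mon \<mu> x)"
    "\<forall>(c, \<mu>)\<in>set ds. 0 \<le> c \<and> set_mset \<mu> \<subseteq> V" "g = (\<lambda>x. \<Sum>(c, \<mu>)\<leftarrow>ds. c * mon \<mu> x)"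
    by auto
  then show ?case by (intro exI[of _ "cs @ ds"]) auto
next
  case (mult f g)
  then obtain cs ds where *:
    "\<forall>(c, \<mu>)\<in>set cs. 0 \<le> c \<and> set_mset \<mu> \<subseteq> V" "f = (\<lambda>x. \<Sum>(c, \<mu>)\<leftarrow>cs. c * mon \<mu> x)"
    "\<forall>(c, \<mu>)\<in>set ds. 0 \<le> c \<and> set_mset \<mu> \<subseteq> V" "g = (\<lambda>x. \<Sum>(c, \<mu>)\<leftarrow>ds. c * mon \<mu> x)"
    by auto
  define row where "row = (\<lambda>(c, \<mu>). map (\<lambda>(d, \<nu>). (c * d, \<mu> + \<nu>)) ds :: (real \<times> 'a multiset) list)"
  have row: "(\<Sum>(c, \<mu>)\<leftarrow>row p. c * mon \<mu> x) = (case p of (c, \<mu>) \<Rightarrow> c * mon \<mu> x) * g x" for p x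
    unfolding row_def *(4)
    by (cases p)
      (auto simp: sum_list_const_mult[symmetric] comp_def case_prod_unfold mult.assoc mult.left_commute
        intro!: arg_cong[where f = sum_list])
  have "(\<Sum>(c, \<mu>)\<leftarrow>concat (map row cs'). c * mon \<mu> x) = (\<Sum>(c, \<mu>)\<leftarrow>cs'. c * mon \<mu> x) * g x" for cs' x
    by (induction cs') (auto simp: row distrib_right)
  then show ?case
    using *(1,3) unfolding *(2)
    by (intro exI[of _ "concat (map row cs)"]) (fastforce simp: row_def)
qed

text \<open>A property that is linear in \<open>f\<close> has to be checked on one monomial at a
  time. Integrability, integration by parts and positive correlation are all proved this
  way.\<close>

lemma pos_poly_mon_induct [consumes 1, case_names zero add]:
  assumes "pos_poly V f"
    and "P (\<lambda>x. 0)"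
    and "\<And>c \<mu> g. 0 \<le> c \<Longrightarrow> set_mset \<mu> \<subseteq> V \<Longrightarrow> pos_poly V g \<Longrightarrow> P g \<Longrightarrow> P (\<lambda>x. c * mon \<mu> x + g x)"
  shows "P f"
proof -
  obtain cs where cs: "\<forall>(c, \<mu>)\<in>set cs. 0 \<le> c \<and> set_mset \<mu> \<subseteq> V"
    and f: "f = (\<lambda>x. \<Sum>(c, \<mu>)\<leftarrow>cs. c * mon \<mu> x)"
    using pos_poly_as_sum_mon[OF assms(1)] by blast
  from cs have "pos_poly V (\<lambda>x. \<Sum>(c, \<mu>)\<leftarrow>cs. c * mon \<mu> x) \<and> P (\<lambda>x. \<Sum>(c, \<mu>)\<leftarrow>cs. c * mon \<mu> x)"
    by (induction cs) (auto intro!: assms(2,3) pos_poly.intros pos_poly_mon)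
  then show ?thesis by (simp add: f)
qed

section \<open>Partial derivatives\<close>

definition pd :: "'v \<Rightarrow> (('v \<Rightarrow> real) \<Rightarrow> real) \<Rightarrow> ('v \<Rightarrow> real) \<Rightarrow> real" where
  "pd v f x = deriv (\<lambda>t. f (x(v := t))) (x v)"

lemma pos_poly_differentiable:
  "pos_poly V f \<Longrightarrow> (\<lambda>t. f (x(v := t))) field_differentiable at t0"
proof (induction rule: pos_poly.induct)
  case (var w)
  then show ?case by (cases "w = v") (auto simp: field_differentiable_ident)
qed (auto intro: field_differentiable_add field_differentiable_mult)

lemma pd_const: "pd v (\<lambda>x. c) = (\<lambda>x. 0)"
  by (auto simp: pd_def)

lemma pd_var: "pd v (\<lambda>x. x w) = (\<lambda>x. of_bool (w = v))"
  by (auto simp: pd_def)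

lemma pd_add: "pos_poly V f \<Longrightarrow> pos_poly V g \<Longrightarrow> pd v (\<lambda>x. f x + g x) = (\<lambda>x. pd v f x + pd v g x)"
  by (rule ext) (simp add: pd_def pos_poly_differentiable)

lemma pd_mult:
  "pos_poly V f \<Longrightarrow> pos_poly V g \<Longrightarrow> pd v (\<lambda>x. f x * g x) = (\<lambda>x. f x * pd v g x + pd v f x * g x)"
  by (rule ext) (simp add: pd_def pos_poly_differentiable)

lemma pd_cmult: "0 \<le> c \<Longrightarrow> pos_poly V f \<Longrightarrow> pd v (\<lambda>x. c * f x) = (\<lambda>x. c * pd v f x)"
  by (subst pd_mult[OF pos_poly.const]) (auto simp: pd_const)

lemma pd_sum:
  "(\<And>i. i \<in> A \<Longrightarrow> pos_poly V (f i)) \<Longrightarrow> pd v (\<lambda>x. \<Sum>i\<in>A. f i x) = (\<lambda>x. \<Sum>i\<in>A. pd v (f i) x)"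
proof (induction A rule: infinite_finite_induct)
  case (insert a A)
  then show ?case
    using pd_add[of V "f a" "\<lambda>x. \<Sum>i\<in>A. f i x" v] by (simp add: pos_poly_sum)
qed (auto simp: pd_const)

lemma pd_power_Suc:
  assumes "pos_poly V f"
  shows "pd v (\<lambda>x. f x ^ Suc k) = (\<lambda>x. real (Suc k) * f x ^ k * pd v f x)"
proof (induction k)
  case (Suc k)
  have "pd v (\<lambda>x. f x * f x ^ Suc k) = (\<lambda>x. f x * pd v (\<lambda>x. f x ^ Suc k) x + pd v f x * f x ^ Suc k)"
    by (rule pd_mult[OF assms pos_poly_power[OF assms]])
  also have "\<dots> = (\<lambda>x. real (Suc (Suc k)) * f x ^ Suc k * pd v f x)"
    by (rule ext) (subst Suc, simp add: algebra_simps)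
  finally show ?case by simp
qed simp

lemma pd_notin: "pos_poly V f \<Longrightarrow> v \<notin> V \<Longrightarrow> pd v f = (\<lambda>x. 0)"
  by (induction rule: pos_poly.induct) (auto simp: pd_const pd_var pd_add pd_mult)

lemma pos_poly_pd: "pos_poly V f \<Longrightarrow> pos_poly V (pd v f)"
  by (induction rule: pos_poly.induct)
    (auto simp: pd_const pd_var pd_add pd_mult intro!: pos_poly.intros)

text \<open>If \<open>v\<close> does not occur in \<open>\<mu>\<close>, the multiset difference
  removes nothing, but then the factor \<open>count \<mu> v\<close> is zero.\<close>

lemma pd_mon: "pd v (mon \<mu>) = (\<lambda>x. real (count \<mu> v) * mon (\<mu> - {#v#}) x)"
proof (induction \<mu>)
  case empty
  then show ?case using pd_const[of v 1] by (simp add: mon_def[abs_def])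
next
  case (add w \<mu>)
  have "mon (add_mset w \<mu>) = (\<lambda>x. x w * mon \<mu> x)" by auto
  then have "pd v (mon (add_mset w \<mu>)) =
      (\<lambda>x. x w * (real (count \<mu> v) * mon (\<mu> - {#v#}) x) + of_bool (w = v) * mon \<mu> x)"
    using pd_mult[OF pos_poly.var[of w UNIV] pos_poly_mon[of \<mu> UNIV], of v] add
    by (simp add: pd_var)
  also have "\<dots> = (\<lambda>x. real (count (add_mset w \<mu>) v) * mon (add_mset w \<mu> - {#v#}) x)"
  proof
    fix x
    show "x w * (real (count \<mu> v) * mon (\<mu> - {#v#}) x) + of_bool (w = v) * mon \<mu> x =
      real (count (add_mset w \<mu>) v) * mon (add_mset w \<mu> - {#v#}) x"
    proof (cases "w = v")
      case True
      show ?thesis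
      proof (cases "v \<in># \<mu>")
        case True
        then obtain \<nu> where "\<mu> = add_mset v \<nu>" by (metis insert_DiffM)
        then show ?thesis using \<open>w = v\<close> by (simp add: algebra_simps)
      next
        case False
        then show ?thesis using \<open>w = v\<close> by (simp add: not_in_iff)
      qed
    next
      case False
      then show ?thesis by (simp add: diff_union_swap[symmetric])
    qed
  qed
  finally show ?case .
qed

text \<open>This records integrability and the Wick recursion for monomials, that is, Gaussian
  integration by parts with variance \<open>s\<close>. Together with total mass 1 it determines
  every moment, so the results apply both to the given matrices and to a reference model.\<close>

locale gauss_family = prob_space M for M :: "'w measure" +
  fixes X :: "'v \<Rightarrow> 'w \<Rightarrow> real" and V :: "'v set" and s :: real
  assumes s_nonneg: "0 \<le> s"
    and integrable_mon: "set_mset \<mu> \<subseteq> V \<Longrightarrow> integrable M (\<lambda>\<omega>. mon \<mu> (\<lambda>v. X v \<omega>))"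
    and wick: "v \<in> V \<Longrightarrow> set_mset \<mu> \<subseteq> V \<Longrightarrow>
      expectation (\<lambda>\<omega>. mon (add_mset v \<mu>) (\<lambda>v. X v \<omega>)) =
        s * (real (count \<mu> v) * expectation (\<lambda>\<omega>. mon (\<mu> - {#v#}) (\<lambda>v. X v \<omega>)))"
begin

definition EE :: "(('v \<Rightarrow> real) \<Rightarrow> real) \<Rightarrow> real" where
  "EE f = expectation (\<lambda>\<omega>. f (\<lambda>v. X v \<omega>))"

lemma integrable_pos_poly: "pos_poly V f \<Longrightarrow> integrable M (\<lambda>\<omega>. f (\<lambda>v. X v \<omega>))"
  by (induction rule: pos_poly_mon_induct)
    (auto intro!: Bochner_Integration.integrable_add integrable_mult_right integrable_mon)

lemma EE_const [simp]: "EE (\<lambda>x. c) = c"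
  by (simp add: EE_def prob_space)

lemma EE_add: "pos_poly V f \<Longrightarrow> pos_poly V g \<Longrightarrow> EE (\<lambda>x. f x + g x) = EE f + EE g"
  by (simp add: EE_def integrable_pos_poly)

lemma EE_cmult: "EE (\<lambda>x. c * f x) = c * EE f"
  by (simp add: EE_def)

lemma EE_sum:
  "(\<And>i. i \<in> A \<Longrightarrow> pos_poly V (f i)) \<Longrightarrow> EE (\<lambda>x. \<Sum>i\<in>A. f i x) = (\<Sum>i\<in>A. EE (f i))"
  unfolding EE_def by (rule Bochner_Integration.integral_sum) (rule integrable_pos_poly)

text \<open>The assumption \<open>wick\<close> is the case of a single monomial, and both sides are
  linear in \<open>f\<close>.\<close>

lemma ibp:
  assumes "pos_poly V f" "v \<in> V"
  shows "EE (\<lambda>x. x v * f x) = s * EE (pd v f)"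
  using assms(1)
proof (induction rule: pos_poly_mon_induct)
  case zero
  then show ?case by (simp add: pd_const)
next
  case (add c \<mu> g)
  note m = pos_poly_mon[OF add(2)]
  have "EE (\<lambda>x. x v * (c * mon \<mu> x + g x)) = EE (\<lambda>x. c * mon (add_mset v \<mu>) x + x v * g x)"
    by (simp add: algebra_simps)
  also have "\<dots> = c * EE (mon (add_mset v \<mu>)) + EE (\<lambda>x. x v * g x)"
    using add assms(2)
    by (subst EE_add) (auto simp: EE_cmult mon_add_mset_fun intro!: pos_poly.intros pos_poly_mon)
  also have "\<dots> = c * (s * (real (count \<mu> v) * EE (mon (\<mu> - {#v#})))) + s * EE (pd v g)"
    using wick[OF assms(2) add(2)] add(4) by (simp add: EE_def)
  also have "\<dots> = s * EE (\<lambda>x. c * pd v (mon \<mu>) x + pd v g x)"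
    using add m
    by (subst EE_add) (auto simp: EE_cmult pd_mon algebra_simps
      intro!: pos_poly.intros pos_poly_pd pos_poly_mon dest: in_diffD)
  also have "(\<lambda>x. c * pd v (mon \<mu>) x + pd v g x) = pd v (\<lambda>x. c * mon \<mu> x + g x)"
    using add m by (simp add: pd_add[OF pos_poly.mult[OF pos_poly.const]] pd_cmult)
  finally show ?case .
qed

text \<open>The Wick recursion lowers the degree by two with a nonnegative factor, until the empty
  monomial or a zero coefficient is reached.\<close>

lemma EE_mon_nonneg: "set_mset \<mu> \<subseteq> V \<Longrightarrow> 0 \<le> EE (mon \<mu>)"
proof (induction "size \<mu>" arbitrary: \<mu> rule: less_induct)
  case less
  show ?case
  proof (cases \<mu>)
    case empty
    then show ?thesis by (simp add: EE_def prob_space)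
  next
    case (add v \<nu>)
    have "0 \<le> EE (mon (\<nu> - {#v#}))" if "v \<in># \<nu>"
      using less add that by (intro less(1)) (auto simp: size_Diff_singleton dest: in_diffD)
    then have "0 \<le> real (count \<nu> v) * EE (mon (\<nu> - {#v#}))"
      by (cases "v \<in># \<nu>") (auto simp: not_in_iff)
    then show ?thesis
      using less(2) add wick[of v \<nu>] s_nonneg by (simp add: EE_def)
  qed
qed

lemma EE_nonneg: "pos_poly V f \<Longrightarrow> 0 \<le> EE f"
  by (induction rule: pos_poly_mon_induct)
    (auto simp: EE_add EE_cmult EE_mon_nonneg pos_poly_mon pos_poly.intros)

text \<open>On the right a variable of \<open>\<mu>\<close> may be paired inside
  \<open>\<mu>\<close> or with a partner in \<open>\<nu>\<close>; on the left only the first kind of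
  pairing occurs. The additional pairings are nonnegative.\<close>

lemma EE_mon_add_ge:
  "set_mset \<mu> \<subseteq> V \<Longrightarrow> set_mset \<nu> \<subseteq> V \<Longrightarrow> EE (mon \<mu>) * EE (mon \<nu>) \<le> EE (mon (\<mu> + \<nu>))"
proof (induction "size \<mu>" arbitrary: \<mu> rule: less_induct)
  case less
  show ?case
  proof (cases \<mu>)
    case empty
    then show ?thesis by (simp add: EE_def prob_space)
  next
    case (add v \<kappa>)
    have *: "EE (mon \<mu>) * EE (mon \<nu>) = s * (real (count \<kappa> v) * (EE (mon (\<kappa> - {#v#})) * EE (mon \<nu>)))"
      using less(2) add wick[of v \<kappa>] by (simp add: EE_def)
    show ?thesis
    proof (cases "v \<in># \<kappa>")
      case False
      then have "EE (mon \<mu>) * EE (mon \<nu>) = 0" using * by (simp add: not_in_iff)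
      then show ?thesis using EE_mon_nonneg[of "\<mu> + \<nu>"] less by auto
    next
      case True
      have sub: "set_mset (\<kappa> - {#v#}) \<subseteq> V" using less(2) add by (auto dest: in_diffD)
      have "EE (mon (\<kappa> - {#v#})) * EE (mon \<nu>) \<le> EE (mon ((\<kappa> - {#v#}) + \<nu>))"
        using add True less(3) sub by (intro less(1)) (auto simp: size_Diff_singleton)
      moreover have "0 \<le> EE (mon (\<kappa> - {#v#}))" "0 \<le> EE (mon \<nu>)"
        using sub less(3) by (auto intro: EE_mon_nonneg)
      ultimately have "EE (mon \<mu>) * EE (mon \<nu>) \<le> s * (real (count (\<kappa> + \<nu>) v) * EE (mon ((\<kappa> - {#v#}) + \<nu>)))"
        unfolding * using s_nonneg by (intro mult_left_mono mult_mono') auto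
      also have "(\<kappa> - {#v#}) + \<nu> = (\<kappa> + \<nu>) - {#v#}"
        using True by (simp add: multiset_eq_iff)
      also have "s * (real (count (\<kappa> + \<nu>) v) * EE (mon ((\<kappa> + \<nu>) - {#v#}))) = EE (mon (\<mu> + \<nu>))"
        using less(2,3) add wick[of v "\<kappa> + \<nu>"] by (simp add: EE_def del: mon_simps(3))
      finally show ?thesis .
    qed
  qed
qed

text \<open>Bilinearity reduces positive correlation to two monomials: the outer induction runs over
  \<open>f\<close>, the inner one over \<open>g\<close>.\<close>

lemma EE_mult_ge:
  assumes "pos_poly V f" "pos_poly V g"
  shows "EE f * EE g \<le> EE (\<lambda>x. f x * g x)"
  using assms(1)
proof (induction rule: pos_poly_mon_induct)
  case zero
  then show ?case by simp
next
  case (add c \<mu> f)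
  note m = pos_poly_mon[OF add(2)]
  have "EE (mon \<mu>) * EE g \<le> EE (\<lambda>x. mon \<mu> x * g x)"
    using assms(2)
  proof (induction rule: pos_poly_mon_induct)
    case zero
    then show ?case by simp
  next
    case (add d \<nu> g)
    note n = pos_poly_mon[OF add(2)]
    have "EE (\<lambda>x. mon \<mu> x * (d * mon \<nu> x + g x)) = EE (\<lambda>x. d * mon (\<mu> + \<nu>) x + mon \<mu> x * g x)"
      by (simp add: algebra_simps)
    also have "\<dots> = d * EE (mon (\<mu> + \<nu>)) + EE (\<lambda>x. mon \<mu> x * g x)"
      using add m n \<open>set_mset \<mu> \<subseteq> V\<close>
      by (subst EE_add) (auto simp: EE_cmult mon_union_fun intro!: pos_poly.intros pos_poly_mon)
    also have "\<dots> \<ge> d * (EE (mon \<mu>) * EE (mon \<nu>)) + EE (mon \<mu>) * EE g"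
      using EE_mon_add_ge[OF \<open>set_mset \<mu> \<subseteq> V\<close> add(2)] add by (intro add_mono mult_left_mono) auto
    also have "d * (EE (mon \<mu>) * EE (mon \<nu>)) + EE (mon \<mu>) * EE g = EE (mon \<mu>) * EE (\<lambda>x. d * mon \<nu> x + g x)"
      using add n by (subst EE_add) (auto simp: EE_cmult algebra_simps intro!: pos_poly.intros)
    finally show ?case .
  qed
  then have "c * (EE (mon \<mu>) * EE g) + EE f * EE g \<le> c * EE (\<lambda>x. mon \<mu> x * g x) + EE (\<lambda>x. f x * g x)"
    using add by (intro add_mono mult_left_mono) auto
  also have "\<dots> = EE (\<lambda>x. c * (mon \<mu> x * g x) + f x * g x)"
    using add m assms(2) by (subst EE_add) (auto simp: EE_cmult intro!: pos_poly.intros)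
  also have "\<dots> = EE (\<lambda>x. (c * mon \<mu> x + f x) * g x)"
    by (simp add: algebra_simps)
  finally show ?case
    using add m by (subst EE_add) (auto simp: EE_cmult algebra_simps intro!: pos_poly.intros)
qed

end

text \<open>The Wick recursion computes all moments without reference to the probability space.
  Expectations can therefore be transferred to another model, even one with additional
  variables.\<close>

lemma EE_eqI:
  assumes "gauss_family M X V s" "gauss_family N Y V' s" "pos_poly V f" "V \<subseteq> V'"
  shows "gauss_family.EE M X f = gauss_family.EE N Y f"
proof -
  interpret A: gauss_family M X V s by fact
  interpret B: gauss_family N Y V' s by fact
  have mon: "A.EE (mon \<mu>) = B.EE (mon \<mu>)" if "set_mset \<mu> \<subseteq> V" for \<mu>
    using that
  proof (induction "size \<mu>" arbitrary: \<mu> rule: less_induct)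
    case less
    show ?case
    proof (cases \<mu>)
      case empty
      then show ?thesis by (simp add: A.EE_def B.EE_def A.prob_space B.prob_space)
    next
      case (add v \<nu>)
      have "A.EE (mon (\<nu> - {#v#})) = B.EE (mon (\<nu> - {#v#}))" if "v \<in># \<nu>"
        using less add that by (intro less(1)) (auto simp: size_Diff_singleton dest: in_diffD)
      then have "real (count \<nu> v) * A.EE (mon (\<nu> - {#v#})) = real (count \<nu> v) * B.EE (mon (\<nu> - {#v#}))"
        by (cases "v \<in># \<nu>") (auto simp: not_in_iff)
      then show ?thesis
        using less(2) add A.wick[of v \<nu>] B.wick[of v \<nu>] assms(4)
        by (simp add: A.EE_def B.EE_def subset_iff)
    qed
  qed
  from assms(3) show ?thesis
  proof (induction rule: pos_poly_mon_induct)
    case (add c \<mu> g)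
    note p = pos_poly_mon[OF add(2)] add(1,3)
    note p' = p(1,3)[THEN pos_poly_mono[OF _ assms(4)]]
    show ?case
      using p p' add mon
      by (subst A.EE_add, (auto intro: pos_poly.intros)[2], subst B.EE_add,
          (auto intro: pos_poly.intros)[2]) (simp add: A.EE_cmult B.EE_cmult)
  qed simp
qed

section \<open>Traces of words and loop equations\<close>

text \<open>The letter \<open>(k, False)\<close> stands for the \<open>k\<close>-th matrix, \<open>(k, True)\<close> for its transpose; the variable
  \<open>(k, a, b)\<close> is the entry in row \<open>a\<close> and column \<open>b\<close> of the \<open>k\<close>-th matrix.\<close>

type_synonym letter = "nat \<times> bool"

definition opp :: "letter \<Rightarrow> letter" where
  "opp l = (fst l, \<not> snd l)"

definition lvar :: "letter \<Rightarrow> nat \<Rightarrow> nat \<Rightarrow> nat \<times> nat \<times> nat" where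
  "lvar l a b = (if snd l then (fst l, b, a) else (fst l, a, b))"

definition vars :: "nat \<Rightarrow> nat set \<Rightarrow> (nat \<times> nat \<times> nat) set" where
  "vars n R = R \<times> {..<n} \<times> {..<n}"

text \<open>The entry \<open>(a, b)\<close> of the product of matrices spelled by the word, as a
  polynomial in the entries of the single matrices.\<close>

fun ent :: "nat \<Rightarrow> letter list \<Rightarrow> nat \<Rightarrow> nat \<Rightarrow> (nat \<times> nat \<times> nat \<Rightarrow> real) \<Rightarrow> real" where
  "ent n [] a b x = of_bool (a = b)"
| "ent n (l # w) a b x = (\<Sum>c<n. x (lvar l a c) * ent n w c b x)"

definition trw :: "nat \<Rightarrow> letter list \<Rightarrow> (nat \<times> nat \<times> nat \<Rightarrow> real) \<Rightarrow> real" where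
  "trw n w x = (\<Sum>a<n. ent n w a a x)"

definition prtr :: "nat \<Rightarrow> letter list list \<Rightarrow> (nat \<times> nat \<times> nat \<Rightarrow> real) \<Rightarrow> real" where
  "prtr n ws x = (\<Prod>w\<leftarrow>ws. trw n w x)"

text \<open>The word that spells the transposed product.\<close>

definition flip :: "letter list \<Rightarrow> letter list" where
  "flip w = rev (map opp w)"

definition idx :: "letter list \<Rightarrow> nat set" where
  "idx w = fst ` set w"

lemma idx_simps [simp]: "idx [] = {}" "idx (l # w) = insert (fst l) (idx w)" "idx (u @ w) = idx u \<union> idx w"
  by (auto simp: idx_def)

lemma idx_take: "idx (take i w) \<subseteq> idx w" and idx_drop: "idx (drop i w) \<subseteq> idx w"
  unfolding idx_def by (intro image_mono set_take_subset set_drop_subset)+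

lemma opp_simps [simp]: "opp (opp l) = l" "fst (opp l) = fst l" "opp l \<noteq> l" "l \<noteq> opp l"
  by (auto simp: opp_def prod_eq_iff)

lemma lvar_opp: "lvar (opp l) a b = lvar l b a"
  by (auto simp: opp_def lvar_def)

lemma lvar_eq_iff:
  "lvar k a e = lvar l c d \<longleftrightarrow> (k = l \<and> a = c \<and> e = d) \<or> (k = opp l \<and> a = d \<and> e = c)"
  by (auto simp: opp_def lvar_def prod_eq_iff)

lemma lvar_in_vars: "fst l \<in> R \<Longrightarrow> a < n \<Longrightarrow> b < n \<Longrightarrow> lvar l a b \<in> vars n R"
  by (auto simp: lvar_def vars_def)

lemma flip_simps: "flip [] = []" "flip (l # w) = flip w @ [opp l]" "flip (u @ w) = flip w @ flip u"
  "length (flip w) = length w" "flip (flip w) = w" "idx (flip w) = idx w"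
  by (auto simp: flip_def idx_def rev_map image_image comp_def)

lemma ent_append: "a < n \<Longrightarrow> ent n (u @ w) a b x = (\<Sum>c<n. ent n u a c x * ent n w c b x)"
proof (induction u arbitrary: a)
  case (Cons l u)
  have "ent n ((l # u) @ w) a b x = (\<Sum>d<n. \<Sum>c<n. x (lvar l a d) * (ent n u d c x * ent n w c b x))"
    using Cons by (simp add: sum_distrib_left)
  also have "\<dots> = (\<Sum>c<n. \<Sum>d<n. x (lvar l a d) * (ent n u d c x * ent n w c b x))"
    by (rule sum.swap)
  finally show ?case by (simp add: sum_distrib_right mult.assoc)
qed simp

lemma ent_flip: "a < n \<Longrightarrow> b < n \<Longrightarrow> ent n (flip w) a b x = ent n w b a x"
  by (induction w arbitrary: a b)
    (auto simp: flip_simps ent_append lvar_opp mult.commute intro!: sum.cong)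

lemma trw_append: "trw n (u @ w) x = (\<Sum>a<n. \<Sum>c<n. ent n u a c x * ent n w c a x)"
  by (simp add: trw_def ent_append)

lemma trw_rotate: "trw n (u @ w) x = trw n (w @ u) x"
  unfolding trw_append by (subst sum.swap) (simp add: mult.commute)

lemma trw_append_flip: "trw n (u @ flip w) x = (\<Sum>a<n. \<Sum>c<n. ent n u a c x * ent n w a c x)"
  by (simp add: trw_append ent_flip)

lemma trw_Nil: "trw n [] x = real n"
  by (simp add: trw_def)

lemma pos_poly_ent:
  "idx w \<subseteq> R \<Longrightarrow> a < n \<Longrightarrow> b < n \<Longrightarrow> pos_poly (vars n R) (ent n w a b)"
proof (induction w arbitrary: a)
  case Nil
  have "ent n [] a b = (\<lambda>x. if a = b then 1 else 0)" by auto
  then show ?case using pos_poly.const[of 1 "vars n R"] pos_poly.const[of 0 "vars n R"] by (cases "a = b") auto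
next
  case (Cons l w)
  have "ent n (l # w) a b = (\<lambda>x. \<Sum>c<n. x (lvar l a c) * ent n w c b x)" by auto
  then show ?case
    using Cons by (auto intro!: pos_poly_sum pos_poly.mult pos_poly.var lvar_in_vars)
qed

lemma pos_poly_trw: "idx w \<subseteq> R \<Longrightarrow> pos_poly (vars n R) (trw n w)"
  unfolding trw_def[abs_def] by (auto intro!: pos_poly_sum pos_poly_ent)

lemma pos_poly_prtr: "idx (concat ws) \<subseteq> R \<Longrightarrow> pos_poly (vars n R) (prtr n ws)"
proof (induction ws)
  case Nil
  then show ?case using pos_poly.const[of 1] by (simp add: prtr_def[abs_def])
next
  case (Cons w ws)
  have "prtr n (w # ws) = (\<lambda>x. trw n w x * prtr n ws x)" by (auto simp: prtr_def)
  then show ?case using Cons by (auto intro!: pos_poly.mult pos_poly_trw)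
qed

lemma prtr_simps [simp]: "prtr n [] x = 1" "prtr n (w # ws) x = trw n w x * prtr n ws x"
  "prtr n (us @ ws) x = prtr n us x * prtr n ws x"
  by (auto simp: prtr_def)

text \<open>Leibniz rule: each occurrence of the matrix that holds the variable is deleted in turn,
  which breaks the word into two entries. An occurrence with the opposite transposition sees row and
  column of the variable exchanged.\<close>

lemma pd_ent:
  assumes "c < n" "d < n" "b < n" "a < n"
  shows "pd (lvar l c d) (ent n w a b) x =
    (\<Sum>i<length w. if w ! i = l then ent n (take i w) a c x * ent n (drop (Suc i) w) d b x
      else if w ! i = opp l then ent n (take i w) a d x * ent n (drop (Suc i) w) c b x else 0)"
  using assms(4)
proof (induction w arbitrary: a)
  case Nil
  have "ent n [] a b = (\<lambda>x. of_bool (a = b))" by auto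
  then show ?case by (simp add: pd_const)
next
  case (Cons k w)
  define T where "T = (\<lambda>w a i. if w ! i = l then ent n (take i w) a c x * ent n (drop (Suc i) w) d b x
      else if w ! i = opp l then ent n (take i w) a d x * ent n (drop (Suc i) w) c b x else 0)"
  have pp: "pos_poly UNIV (ent n w e b)" if "e < n" for e
    using pos_poly_ent[of w UNIV e n b] that assms(3) by (auto intro: pos_poly_mono)
  have eq: "ent n (k # w) a b = (\<lambda>x. \<Sum>e<n. x (lvar k a e) * ent n w e b x)" by auto
  have pp': "pos_poly UNIV (\<lambda>x. x (lvar k a e) * ent n w e b x)" if "e < n" for e
    using that by (intro pos_poly.mult pos_poly.var pp) auto
  have pde: "pd (lvar l c d) (\<lambda>x. x (lvar k a e) * ent n w e b x) x =
      x (lvar k a e) * pd (lvar l c d) (ent n w e b) x + of_bool (lvar k a e = lvar l c d) * ent n w e b x"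
    if "e < n" for e
    using pp[OF that] by (subst pd_mult[OF pos_poly.var]) (auto simp: pd_var)
  have "pd (lvar l c d) (ent n (k # w) a b) x =
      (\<Sum>e<n. x (lvar k a e) * pd (lvar l c d) (ent n w e b) x) +
      (\<Sum>e<n. of_bool (lvar k a e = lvar l c d) * ent n w e b x)"
    unfolding eq using pp' by (subst pd_sum[where V = UNIV]) (auto simp: pde sum.distrib)
  also have "(\<Sum>e<n. x (lvar k a e) * pd (lvar l c d) (ent n w e b) x) =
      (\<Sum>e<n. \<Sum>i<length w. x (lvar k a e) * T w e i)"
    using Cons.IH by (simp add: T_def sum_distrib_left)
  \<comment> \<open>Positions in \<open>w\<close> move up by one behind the letter \<open>k\<close>;
    differentiating \<open>k\<close> itself supplies position 0.\<close>
  also have "\<dots> = (\<Sum>i<length w. T (k # w) a (Suc i))"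
    by (subst sum.swap) (auto simp: T_def sum_distrib_right mult.assoc intro!: sum.cong)
  also have "(\<Sum>e<n. of_bool (lvar k a e = lvar l c d) * ent n w e b x) = T (k # w) a 0"
  proof (cases "k = l")
    case True
    then show ?thesis using assms by (cases "a = c") (auto simp: T_def lvar_eq_iff)
  next
    case False
    then show ?thesis using assms by (cases "a = d") (auto simp: T_def lvar_eq_iff)
  qed
  finally show ?case by (simp add: T_def sum.lessThan_Suc_shift del: sum.lessThan_Suc)
qed

text \<open>Deleting a letter opens the cyclic word, so the two pieces join into one entry of a
  rotated word.\<close>

lemma pd_trw:
  assumes "c < n" "d < n"
  shows "pd (lvar l c d) (trw n w) x =
    (\<Sum>i<length w. if w ! i = l then ent n (drop (Suc i) w @ take i w) d c x
      else if w ! i = opp l then ent n (drop (Suc i) w @ take i w) c d x else 0)"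
proof -
  have "pd (lvar l c d) (trw n w) x = (\<Sum>a<n. pd (lvar l c d) (ent n w a a) x)"
    unfolding trw_def[abs_def]
    by (subst pd_sum[where V = UNIV])
      (auto intro: pos_poly_mono[OF pos_poly_ent[where R = UNIV]])
  also have "\<dots> = (\<Sum>i<length w. \<Sum>a<n.
      if w ! i = l then ent n (take i w) a c x * ent n (drop (Suc i) w) d a x
      else if w ! i = opp l then ent n (take i w) a d x * ent n (drop (Suc i) w) c a x else 0)"
    using assms by (subst sum.swap) (simp add: pd_ent)
  also have "\<dots> = (\<Sum>i<length w. if w ! i = l then ent n (drop (Suc i) w @ take i w) d c x
      else if w ! i = opp l then ent n (drop (Suc i) w @ take i w) c d x else 0)"
    using assms by (intro sum.cong) (auto simp: ent_append mult.commute)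
  finally show ?thesis .
qed

section \<open>Splitting and merging of traces\<close>

text \<open>Integration by parts removes the letter \<open>l\<close> in front of \<open>w\<close> together with a partner. A partner in \<open>w\<close>
  that is transposed relative to \<open>l\<close> splits the trace in two, an equal one reverses the rest of the
  word; a partner in another trace merges the two traces.\<close>

definition splits :: "letter \<Rightarrow> letter list \<Rightarrow> letter list list list" where
  "splits l w = concat (map (\<lambda>i. if w ! i = opp l then [[take i w, drop (Suc i) w]]
     else if w ! i = l then [[take i w @ flip (drop (Suc i) w)]] else []) [0..<length w])"

definition merges :: "letter \<Rightarrow> letter list \<Rightarrow> letter list \<Rightarrow> letter list list" where
  "merges l w w' = concat (map (\<lambda>i. if w' ! i = opp l then [w @ drop (Suc i) w' @ take i w']
     else if w' ! i = l then [w @ flip (drop (Suc i) w' @ take i w')] else []) [0..<length w'])"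

fun mergeall :: "letter \<Rightarrow> letter list \<Rightarrow> letter list list \<Rightarrow> letter list list list" where
  "mergeall l w [] = []"
| "mergeall l w (w' # ws) = map (\<lambda>u. u # ws) (merges l w w') @ map (\<lambda>us. w' # us) (mergeall l w ws)"

definition loops :: "letter \<Rightarrow> letter list \<Rightarrow> letter list list \<Rightarrow> letter list list list" where
  "loops l w ws = map (\<lambda>us. us @ ws) (splits l w) @ mergeall l w ws"

lemma sum_list_concat_map: "(\<Sum>x\<leftarrow>concat (map f xs). (g x :: real)) = (\<Sum>y\<leftarrow>xs. \<Sum>x\<leftarrow>f y. g x)"
  by (induction xs) auto

lemma sum_swap_inner: "(\<Sum>a\<in>A. \<Sum>c\<in>B. \<Sum>i\<in>C. f a c i) = (\<Sum>i\<in>C. \<Sum>a\<in>A. \<Sum>c\<in>B. f a c i)"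
  by (simp add: sum.swap[of _ C])

text \<open>The pieces left by an occurrence of \<open>opp l\<close> carry the index pairs
  \<open>(c, c)\<close> and \<open>(a, a)\<close> and close up separately. Those left by an
  occurrence of \<open>l\<close> both carry \<open>(c, a)\<close>, so transposing the second one
  glues them into a single trace.\<close>

lemma sum_pd_ent:
  "(\<Sum>a<n. \<Sum>c<n. pd (lvar l a c) (ent n w c a) x) = (\<Sum>us\<leftarrow>splits l w. prtr n us x)"
proof -
  have "(\<Sum>a<n. \<Sum>c<n. pd (lvar l a c) (ent n w c a) x) =
    (\<Sum>a<n. \<Sum>c<n. \<Sum>i<length w. if w ! i = l then ent n (take i w) c a x * ent n (drop (Suc i) w) c a x
      else if w ! i = opp l then ent n (take i w) c c x * ent n (drop (Suc i) w) a a x else 0)"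
    by (simp add: pd_ent)
  also have "\<dots> = (\<Sum>i<length w. \<Sum>a<n. \<Sum>c<n.
      if w ! i = l then ent n (take i w) c a x * ent n (drop (Suc i) w) c a x
      else if w ! i = opp l then ent n (take i w) c c x * ent n (drop (Suc i) w) a a x else 0)"
    by (rule sum_swap_inner)
  also have "\<dots> = (\<Sum>i<length w. if w ! i = l then trw n (take i w @ flip (drop (Suc i) w)) x
      else if w ! i = opp l then trw n (take i w) x * trw n (drop (Suc i) w) x else 0)"
  proof (intro sum.cong refl)
    fix i
    have "(\<Sum>a<n. \<Sum>c<n. ent n (take i w) c a x * ent n (drop (Suc i) w) c a x) =
        trw n (take i w @ flip (drop (Suc i) w)) x"
      unfolding trw_append_flip by (rule sum.swap)
    moreover have "(\<Sum>a<n. \<Sum>c<n. ent n (take i w) c c x * ent n (drop (Suc i) w) a a x) =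
        trw n (take i w) x * trw n (drop (Suc i) w) x"
      unfolding trw_def by (subst sum.swap) (simp add: sum_product)
    ultimately show "(\<Sum>a<n. \<Sum>c<n.
      if w ! i = l then ent n (take i w) c a x * ent n (drop (Suc i) w) c a x
      else if w ! i = opp l then ent n (take i w) c c x * ent n (drop (Suc i) w) a a x else 0) =
      (if w ! i = l then trw n (take i w @ flip (drop (Suc i) w)) x
      else if w ! i = opp l then trw n (take i w) x * trw n (drop (Suc i) w) x else 0)"
      by simp
  qed
  also have "\<dots> = (\<Sum>us\<leftarrow>splits l w. prtr n us x)"
    unfolding splits_def sum_list_concat_map
    by (auto simp: interv_sum_list_conv_sum_set_nat atLeast0LessThan intro!: sum.cong)
  finally show ?thesis .
qed

text \<open>The opened trace carries the indices \<open>(c, a)\<close> or \<open>(a, c)\<close>,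
  depending on the deleted letter. Together with \<open>ent n w c a\<close> it closes to one trace,
  after a transposition in the first case.\<close>

lemma sum_ent_pd_trw:
  "(\<Sum>a<n. \<Sum>c<n. ent n w c a x * pd (lvar l a c) (trw n w') x) = (\<Sum>u\<leftarrow>merges l w w'. trw n u x)"
proof -
  define rot where "rot = (\<lambda>i. drop (Suc i) w' @ take i w')"
  have "(\<Sum>a<n. \<Sum>c<n. ent n w c a x * pd (lvar l a c) (trw n w') x) =
    (\<Sum>a<n. \<Sum>c<n. \<Sum>i<length w'. if w' ! i = l then ent n w c a x * ent n (rot i) c a x
      else if w' ! i = opp l then ent n w c a x * ent n (rot i) a c x else 0)"
    by (auto simp: pd_trw rot_def sum_distrib_left intro!: sum.cong)
  also have "\<dots> = (\<Sum>i<length w'. \<Sum>a<n. \<Sum>c<n. if w' ! i = l then ent n w c a x * ent n (rot i) c a x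
      else if w' ! i = opp l then ent n w c a x * ent n (rot i) a c x else 0)"
    by (rule sum_swap_inner)
  also have "\<dots> = (\<Sum>i<length w'. if w' ! i = l then trw n (w @ flip (rot i)) x
      else if w' ! i = opp l then trw n (w @ rot i) x else 0)"
  proof (intro sum.cong refl)
    fix i
    have "(\<Sum>a<n. \<Sum>c<n. ent n w c a x * ent n (rot i) c a x) = trw n (w @ flip (rot i)) x"
      unfolding trw_append_flip by (rule sum.swap)
    moreover have "(\<Sum>a<n. \<Sum>c<n. ent n w c a x * ent n (rot i) a c x) = trw n (w @ rot i) x"
      unfolding trw_append by (rule sum.swap)
    ultimately show "(\<Sum>a<n. \<Sum>c<n. if w' ! i = l then ent n w c a x * ent n (rot i) c a x
        else if w' ! i = opp l then ent n w c a x * ent n (rot i) a c x else 0) =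
      (if w' ! i = l then trw n (w @ flip (rot i)) x
        else if w' ! i = opp l then trw n (w @ rot i) x else 0)"
      by simp
  qed
  also have "\<dots> = (\<Sum>u\<leftarrow>merges l w w'. trw n u x)"
    unfolding merges_def sum_list_concat_map
    by (auto simp: interv_sum_list_conv_sum_set_nat atLeast0LessThan rot_def intro!: sum.cong)
  finally show ?thesis .
qed

lemma sum_ent_pd_prtr:
  "(\<Sum>a<n. \<Sum>c<n. ent n w c a x * pd (lvar l a c) (prtr n ws) x) = (\<Sum>us\<leftarrow>mergeall l w ws. prtr n us x)"
proof (induction ws)
  case Nil
  then show ?case by (simp add: prtr_def[abs_def] pd_const)
next
  case (Cons w' ws)
  have eq: "prtr n (w' # ws) = (\<lambda>x. trw n w' x * prtr n ws x)" by auto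
  have "pd v (prtr n (w' # ws)) x = trw n w' x * pd v (prtr n ws) x + pd v (trw n w') x * prtr n ws x" for v
    unfolding eq
    by (subst pd_mult[OF pos_poly_trw[where R = UNIV and n = n] pos_poly_prtr[where R = UNIV and n = n]]) auto
  then have "(\<Sum>a<n. \<Sum>c<n. ent n w c a x * pd (lvar l a c) (prtr n (w' # ws)) x) =
      (\<Sum>a<n. \<Sum>c<n. ent n w c a x * pd (lvar l a c) (trw n w') x) * prtr n ws x +
      trw n w' x * (\<Sum>a<n. \<Sum>c<n. ent n w c a x * pd (lvar l a c) (prtr n ws) x)"
    by (simp add: distrib_left sum.distrib sum_distrib_left sum_distrib_right mult_ac)
  also have "\<dots> = (\<Sum>us\<leftarrow>mergeall l w (w' # ws). prtr n us x)"
    unfolding Cons sum_ent_pd_trw by (simp add: comp_def sum_list_const_mult sum_list_mult_const)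
  finally show ?case .
qed

lemma length_concat_map_upt_le:
  assumes "\<And>i. length (f i) \<le> 1"
  shows "length (concat (map f [0..<k])) \<le> k"
proof (induction k)
  case (Suc k)
  then show ?case using assms[of k] by simp
qed simp

lemma concat_splits:
  assumes "us \<in> set (splits l w)"
  shows "Suc (length (concat us)) = length w" "idx (concat us) \<subseteq> idx w" "length us \<le> 2"
proof -
  obtain i where i: "i < length w" "us = [take i w, drop (Suc i) w] \<or> us = [take i w @ flip (drop (Suc i) w)]"
    using assms by (auto simp: splits_def split: if_splits)
  show "Suc (length (concat us)) = length w" "idx (concat us) \<subseteq> idx w" "length us \<le> 2"
    using i idx_take[of i w] idx_drop[of "Suc i" w] by (auto simp: flip_simps)
qed

lemma length_splits: "length (splits l w) \<le> length w"
  unfolding splits_def by (rule length_concat_map_upt_le) simp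

lemma merges_props:
  assumes "u \<in> set (merges l w w')"
  shows "Suc (length u) = length w + length w'" "idx u \<subseteq> idx w \<union> idx w'"
proof -
  obtain i where i: "i < length w'" "u = w @ drop (Suc i) w' @ take i w' \<or> u = w @ flip (drop (Suc i) w' @ take i w')"
    using assms by (auto simp: merges_def split: if_splits)
  show "Suc (length u) = length w + length w'" "idx u \<subseteq> idx w \<union> idx w'"
    using i idx_take[of i w'] idx_drop[of "Suc i" w'] by (auto simp: flip_simps)
qed

lemma length_merges: "length (merges l w w') \<le> length w'"
  unfolding merges_def by (rule length_concat_map_upt_le) simp

lemma mergeall_props:
  "us \<in> set (mergeall l w ws) \<Longrightarrow>
    Suc (length (concat us)) = length w + length (concat ws) \<and>
    idx (concat us) \<subseteq> idx w \<union> idx (concat ws) \<and> length us = length ws"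
proof (induction ws arbitrary: us)
  case (Cons w' ws)
  then consider u where "u \<in> set (merges l w w')" "us = u # ws"
    | us' where "us' \<in> set (mergeall l w ws)" "us = w' # us'" by auto
  then show ?case
  proof cases
    case 1
    then show ?thesis using merges_props[OF 1(1)] by auto
  next
    case 2
    then show ?thesis using Cons.IH[OF 2(1)] by auto
  qed
qed simp

lemma length_mergeall: "length (mergeall l w ws) \<le> length (concat ws)"
  by (induction ws) (auto intro: add_mono length_merges)

text \<open>Compared with \<open>(l # w) # ws\<close>, where \<open>l\<close> is counted as well,
  every term has two letters fewer and at most one trace more. The inductions on moments rest on
  this count.\<close>

lemma loops_props:
  assumes "us \<in> set (loops l w ws)"
  shows "Suc (length (concat us)) = length w + length (concat ws) \<and>
    idx (concat us) \<subseteq> idx w \<union> idx (concat ws) \<and> length us \<le> length ws + 2"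
proof -
  consider us' where "us' \<in> set (splits l w)" "us = us' @ ws" | "us \<in> set (mergeall l w ws)"
    using assms by (auto simp: loops_def)
  then show ?thesis
  proof cases
    case 1
    then show ?thesis using concat_splits[OF 1(1)] by auto
  next
    case 2
    then show ?thesis using mergeall_props[OF 2(1)] by auto
  qed
qed

lemma length_loops: "length (loops l w ws) \<le> length w + length (concat ws)"
  by (simp add: loops_def add_mono length_splits length_mergeall)

text \<open>The terms are separated by whether they touch the last trace. Those that do not will
  rebuild a product of expectations; the merges with \<open>w'\<close> make up the
  covariance.\<close>

lemma loops_append:
  "loops l w (ws @ [w']) =
    map (\<lambda>us. us @ [w']) (loops l w ws) @ map (\<lambda>u. ws @ [u]) (merges l w w')"
proof -
  have "mergeall l w (ws @ [w']) = map (\<lambda>us. us @ [w']) (mergeall l w ws) @ map (\<lambda>u. ws @ [u]) (merges l w w')"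
    by (induction ws) (auto simp: comp_def)
  then show ?thesis by (simp add: loops_def comp_def)
qed

section \<open>The loop equation\<close>

locale gauss_words = gauss_family M X "vars n R" s
  for M :: "'w measure" and X n R s
begin

lemma EE_sum_list:
  "(\<And>i. i \<in> set is \<Longrightarrow> pos_poly (vars n R) (f i)) \<Longrightarrow> EE (\<lambda>x. \<Sum>i\<leftarrow>is. f i x) = (\<Sum>i\<leftarrow>is. EE (f i))"
proof (induction "is")
  case (Cons a "is")
  then show ?case
    using EE_add[of "f a" "\<lambda>x. \<Sum>i\<leftarrow>is. f i x"] by (simp add: pos_poly_sum_list)
qed simp

lemma EE_sum2:
  assumes "\<And>a c. a < n' \<Longrightarrow> c < n' \<Longrightarrow> pos_poly (vars n R) (f a c)"
  shows "EE (\<lambda>x. \<Sum>a<n'. \<Sum>c<n'. f a c x) = (\<Sum>a<n'. \<Sum>c<n'. EE (f a c))"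
proof -
  have "EE (\<lambda>x. \<Sum>a<n'. \<Sum>c<n'. f a c x) = (\<Sum>a<n'. EE (\<lambda>x. \<Sum>c<n'. f a c x))"
    by (rule EE_sum) (auto intro!: pos_poly_sum assms)
  also have "\<dots> = (\<Sum>a<n'. \<Sum>c<n'. EE (f a c))"
    by (intro sum.cong refl EE_sum) (auto intro!: assms)
  finally show ?thesis .
qed

text \<open>Expand the first trace into entries of \<open>l\<close> times entries of
  \<open>w\<close> and integrate by parts in each entry of \<open>l\<close>. By the Leibniz rule the
  derivative hits either \<open>w\<close> itself or one of the other traces.\<close>

lemma loop_equation:
  assumes "fst l \<in> R" "idx w \<subseteq> R" "idx (concat ws) \<subseteq> R"
  shows "EE (prtr n ((l # w) # ws)) = s * (\<Sum>us\<leftarrow>loops l w ws. EE (prtr n us))"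
proof -
  note pp = pos_poly_ent[OF assms(2)] pos_poly_prtr[OF assms(3)]
  have pp2: "pos_poly (vars n R) (\<lambda>x. ent n w c a x * prtr n ws x)" if "a < n" "c < n" for a c
    using that by (intro pos_poly.mult pp)
  have ppv: "pos_poly (vars n R) (\<lambda>x. x (lvar l a c))" if "a < n" "c < n" for a c
    using that assms(1) by (intro pos_poly.var lvar_in_vars)
  have "EE (prtr n ((l # w) # ws)) =
      EE (\<lambda>x. \<Sum>a<n. \<Sum>c<n. x (lvar l a c) * (ent n w c a x * prtr n ws x))"
    by (rule arg_cong[where f = EE]) (auto simp: trw_def sum_distrib_right mult.assoc)
  also have "\<dots> = (\<Sum>a<n. \<Sum>c<n. EE (\<lambda>x. x (lvar l a c) * (ent n w c a x * prtr n ws x)))"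
    by (intro EE_sum2 pos_poly.mult[OF ppv pp2])
  also have "\<dots> = (\<Sum>a<n. \<Sum>c<n. s * EE (pd (lvar l a c) (\<lambda>x. ent n w c a x * prtr n ws x)))"
    using pp2 assms(1) by (intro sum.cong refl ibp) (auto intro: lvar_in_vars)
  also have "\<dots> = s * EE (\<lambda>x. \<Sum>a<n. \<Sum>c<n. pd (lvar l a c) (\<lambda>x. ent n w c a x * prtr n ws x) x)"
    by (subst EE_sum2) (auto intro!: pos_poly_pd pp2 simp: sum_distrib_left)
  also have "(\<lambda>x. \<Sum>a<n. \<Sum>c<n. pd (lvar l a c) (\<lambda>x. ent n w c a x * prtr n ws x) x) =
      (\<lambda>x. \<Sum>us\<leftarrow>loops l w ws. prtr n us x)"
  proof
    fix x
    have "(\<Sum>a<n. \<Sum>c<n. pd (lvar l a c) (\<lambda>x. ent n w c a x * prtr n ws x) x) =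
        (\<Sum>a<n. \<Sum>c<n. ent n w c a x * pd (lvar l a c) (prtr n ws) x) +
        (\<Sum>a<n. \<Sum>c<n. pd (lvar l a c) (ent n w c a) x) * prtr n ws x"
      by (simp add: pd_mult[OF pp] sum.distrib sum_distrib_right)
    then show "(\<Sum>a<n. \<Sum>c<n. pd (lvar l a c) (\<lambda>x. ent n w c a x * prtr n ws x) x) =
        (\<Sum>us\<leftarrow>loops l w ws. prtr n us x)"
      unfolding sum_ent_pd_prtr sum_pd_ent
      by (simp add: loops_def comp_def sum_list_mult_const)
  qed
  also have "EE (\<lambda>x. \<Sum>us\<leftarrow>loops l w ws. prtr n us x) = (\<Sum>us\<leftarrow>loops l w ws. EE (prtr n us))"
    using assms by (intro EE_sum_list pos_poly_prtr) (use loops_props in blast)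
  finally show ?thesis .
qed

end

section \<open>Moment bounds from the loop equations\<close>

lemma sum_list_le_length_mult:
  fixes f :: "'a \<Rightarrow> real"
  assumes "\<And>x. x \<in> set xs \<Longrightarrow> f x \<le> B"
  shows "(\<Sum>x\<leftarrow>xs. f x) \<le> real (length xs) * B"
  using assms by (induction xs) (fastforce simp: algebra_simps)+

lemma mult_fact_pred_le: "real L * fact (L - 1) \<le> (fact (Suc L) :: real)"
  by (cases L) (auto intro!: mult_right_mono)

section \<open>Powers of words and the Gram word\<close>

definition wpow :: "letter list \<Rightarrow> nat \<Rightarrow> letter list" where
  "wpow w k = concat (replicate k w)"

lemma wpow_simps [simp]: "wpow w 0 = []" "wpow w (Suc k) = w @ wpow w k"
  and wpow_add: "wpow w (j + k) = wpow w j @ wpow w k"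
  by (auto simp: wpow_def replicate_add)

lemma wpow_Suc': "wpow w (Suc k) = wpow w k @ w"
  using wpow_add[of w k 1] by simp

lemma wpow_shift: "wpow (u @ v) k @ u = u @ wpow (v @ u) k"
  by (induction k) auto

lemma idx_wpow: "idx (wpow w k) \<subseteq> idx w"
  by (induction k) auto

lemma length_wpow: "length (wpow w k) = k * length w"
  by (induction k) auto

lemma flip_wpow: "flip (wpow w k) = wpow (flip w) k"
  by (induction k) (simp_all only: wpow_Suc' flip_simps wpow_simps, simp add: wpow_Suc'[symmetric])

lemma trw_wpow_rotate: "trw n (wpow (u @ v) k) x = trw n (wpow (v @ u) k) x"
proof (cases k)
  case (Suc j)
  have "trw n (wpow (u @ v) k) x = trw n (u @ (wpow (v @ u) j @ v)) x"
    by (simp add: Suc wpow_shift[symmetric])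
  also have "\<dots> = trw n (wpow (v @ u) (Suc j)) x"
    unfolding wpow_Suc' by (subst trw_rotate) simp
  finally show ?thesis by (simp add: Suc)
qed simp

text \<open>The word of the partial product of the matrices with indices \<open>i + 1\<close> to
  \<open>j\<close>; in particular \<open>fwd 0 m\<close> spells \<open>P\<close>.\<close>

definition fwd :: "nat \<Rightarrow> nat \<Rightarrow> letter list" where
  "fwd i j = map (\<lambda>k. (k, False)) [Suc i..<Suc j]"

definition gram :: "nat \<Rightarrow> letter list" where
  "gram m = flip (fwd 0 m) @ fwd 0 m"

text \<open>Deleting from \<open>cut m (Suc r) i\<close> its first letter and one of the matching untransposed letters
  leaves a word \<open>cut m r a\<close> and a word that is cyclically equal to a power of \<open>gram m\<close>.\<close>

definition cut :: "nat \<Rightarrow> nat \<Rightarrow> nat \<Rightarrow> letter list" where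
  "cut m r i = wpow (flip (fwd 0 r) @ fwd 0 r @ fwd r m @ flip (fwd r m)) i @ flip (fwd 0 r) @ fwd 0 r"

lemma fwd_split: "i \<le> j \<Longrightarrow> j \<le> k \<Longrightarrow> fwd i k = fwd i j @ fwd j k"
  unfolding fwd_def by (metis Suc_le_mono map_append upt_add_eq_append le_Suc_ex add_Suc)

lemma fwd_Suc: "i < j \<Longrightarrow> fwd i j = (Suc i, False) # fwd (Suc i) j"
  by (simp add: fwd_def upt_conv_Cons del: upt_Suc)

lemma fwd_Suc': "i \<le> j \<Longrightarrow> fwd i (Suc j) = fwd i j @ [(Suc j, False)]"
  and fwd_refl: "fwd i i = []"
  by (simp_all add: fwd_def)

lemma idx_fwd: "idx (fwd i j) = {Suc i..j}"
  by (auto simp: fwd_def idx_def image_image simp del: upt_Suc)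

lemma idx_gram: "idx (gram m) = {1..m}"
  by (simp add: gram_def flip_simps idx_fwd)

lemma idx_cut: "r \<le> m \<Longrightarrow> idx (cut m r i) \<subseteq> {1..m}"
  using idx_wpow[of "flip (fwd 0 r) @ fwd 0 r @ fwd r m @ flip (fwd r m)" i]
  by (auto simp: cut_def flip_simps idx_fwd)

text \<open>The words \<open>cut m r i\<close> interpolate between consecutive powers of
  \<open>gram m\<close>: \<open>r = 0\<close> is the \<open>i\<close>-th power up to rotation, and
  \<open>r = m\<close> is the next one. So \<open>m\<close> loop equations lead from one power to
  the next.\<close>

lemma trw_cut_0: "trw n (cut m 0 i) x = trw n (wpow (gram m) i) x"
  using trw_wpow_rotate[of n "fwd 0 m" "flip (fwd 0 m)" i x]
  by (simp add: cut_def gram_def fwd_refl flip_simps)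

lemma cut_self: "cut m m i = wpow (gram m) (Suc i)"
  by (simp add: cut_def gram_def fwd_refl flip_simps wpow_Suc' del: wpow_simps(2))

text \<open>With the blocks \<open>B\<close> and \<open>C\<close> below the word is
  \<open>(B C)^i B\<close>. The chosen partner is the last letter of the block \<open>B\<close> with
  number \<open>a\<close>, counted from 0, and what follows it is
  \<open>(C B)^(i - a)\<close>.\<close>

lemma cut_Suc:
  assumes "r < m" "a \<le> i"
  obtains v where "cut m (Suc r) i = (Suc r, True) # cut m r a @ (Suc r, False) # v"
    "\<And>n x. trw n v x = trw n (wpow (gram m) (i - a)) x" "idx v \<subseteq> {1..m}"
proof
  define l where "l = (Suc r, True)"
  define B where "B = l # flip (fwd 0 r) @ fwd 0 r @ [opp l]"
  define C where "C = fwd (Suc r) m @ flip (fwd (Suc r) m)"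
  have opp_l: "opp l = (Suc r, False)" "opp (Suc r, False) = l" by (auto simp: opp_def l_def)
  have B: "flip (fwd 0 (Suc r)) @ fwd 0 (Suc r) = B"
    by (simp add: B_def fwd_Suc' flip_simps opp_l)
  have "cut m (Suc r) i = wpow (B @ C) (a + (i - a)) @ B"
    using assms unfolding cut_def C_def B[symmetric] by simp
  also have "\<dots> = (wpow (B @ C) a @ B) @ wpow (C @ B) (i - a)"
    unfolding wpow_add by (simp add: wpow_shift)
  also have "wpow (B @ C) a @ B = (wpow ([l] @ flip (fwd 0 r) @ fwd 0 r @ [opp l] @ C) a @ [l]) @
      flip (fwd 0 r) @ fwd 0 r @ [opp l]"
    by (simp add: B_def)
  \<comment> \<open>Moving \<open>l\<close> from the end of the power to its front turns the period
    into that of \<open>cut m r a\<close>, because \<open>opp l\<close>, \<open>C\<close>,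
    \<open>l\<close> together spell \<open>fwd r m @ flip (fwd r m)\<close>.\<close>
  also have "\<dots> = l # cut m r a @ [opp l]"
    unfolding wpow_shift using assms(1)
    by (simp add: cut_def C_def fwd_Suc[of r m] flip_simps opp_l)
  finally show "cut m (Suc r) i = (Suc r, True) # cut m r a @ (Suc r, False) # wpow (C @ B) (i - a)"
    by (simp add: opp_l) (simp add: l_def)
  have full: "fwd 0 m = fwd 0 (Suc r) @ fwd (Suc r) m"
    using assms by (intro fwd_split) auto
  show "trw n (wpow (C @ B) (i - a)) x = trw n (wpow (gram m) (i - a)) x" for n x
  proof -
    have "trw n (wpow (C @ B) (i - a)) x = trw n (wpow ((B @ fwd (Suc r) m) @ flip (fwd (Suc r) m)) (i - a)) x"
      by (subst trw_wpow_rotate) (simp add: C_def)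
    also have "\<dots> = trw n (wpow (flip (fwd (Suc r) m) @ B @ fwd (Suc r) m) (i - a)) x"
      by (rule trw_wpow_rotate)
    finally show ?thesis
      unfolding gram_def full B[symmetric] by (simp add: flip_simps)
  qed
  have "idx (wpow (C @ B) (i - a)) \<subseteq> idx C \<union> idx B"
    using idx_wpow[of "C @ B" "i - a"] by simp
  also have "\<dots> \<subseteq> {1..m}"
    using assms unfolding C_def B[symmetric] by (auto simp: flip_simps idx_fwd)
  finally show "idx (wpow (C @ B) (i - a)) \<subseteq> {1..m}" .
qed

lemma length_cut: "length (cut m r i) = i * (2 * m) + 2 * r" if "r \<le> m"
  using that by (simp add: cut_def length_wpow flip_simps fwd_def del: upt_Suc)

section \<open>Uniform bounds for expected products of traces\<close>

locale gauss_mats = gauss_words M X n R "1 / real n"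
  for M :: "'w measure" and X n R +
  assumes n_pos: "1 \<le> n"
begin

lemma EE_prtr_nonneg: "idx (concat ws) \<subseteq> R \<Longrightarrow> 0 \<le> EE (prtr n ws)"
  by (intro EE_nonneg pos_poly_prtr)

lemma EE_prtr_Nil: "EE (prtr n ([] # ws)) = real n * EE (prtr n ws)"
proof -
  have "prtr n ([] # ws) = (\<lambda>x. real n * prtr n ws x)" by (auto simp: trw_Nil)
  then show ?thesis by (simp add: EE_cmult)
qed

lemma prtr_single: "prtr n [w] = trw n w"
  by auto

text \<open>An empty word contributes a factor \<open>n\<close>. Otherwise a loop equation has at
  most as many terms as there are letters left, which builds up the factorial, and its factor
  \<open>1 / n\<close> pays for the trace that a split may create.\<close>

lemma EE_prtr_le:
  "idx (concat ws) \<subseteq> R \<Longrightarrow> EE (prtr n ws) \<le> fact (length (concat ws)) * real n ^ length ws"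
proof (induction "length ws + length (concat ws)" arbitrary: ws rule: less_induct)
  case less
  show ?case
  proof (cases ws)
    case Nil
    then show ?thesis by (simp add: EE_def prob_space)
  next
    case (Cons w ws')
    show ?thesis
    proof (cases w)
      case Nil
      have "EE (prtr n ws') \<le> fact (length (concat ws')) * real n ^ length ws'"
        using less Cons Nil by auto
      then have "real n * EE (prtr n ws') \<le> real n * (fact (length (concat ws')) * real n ^ length ws')"
        by (rule mult_left_mono) simp
      then show ?thesis by (simp add: Cons Nil EE_prtr_Nil mult_ac)
    next
      case (Cons l v)
      define L where "L = length v + length (concat ws')"
      note ws = \<open>ws = w # ws'\<close> \<open>w = l # v\<close>
      have bound: "EE (prtr n us) \<le> fact (L - 1) * real n ^ (length ws' + 2)"
        if us: "us \<in> set (loops l v ws')" for us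
      proof -
        note p = loops_props[OF us]
        have "EE (prtr n us) \<le> fact (length (concat us)) * real n ^ length us"
          using p less(2) unfolding ws by (intro less(1)) (auto simp: ws)
        also have "length (concat us) = L - 1" using p unfolding L_def by linarith
        also have "real n ^ length us \<le> real n ^ (length ws' + 2)"
          using p n_pos by (intro power_increasing) auto
        finally show ?thesis by simp
      qed
      have "EE (prtr n ws) = 1 / real n * (\<Sum>us\<leftarrow>loops l v ws'. EE (prtr n us))"
        using less(2) unfolding ws by (intro loop_equation) auto
      also have "\<dots> \<le> 1 / real n * (real (length (loops l v ws')) * (fact (L - 1) * real n ^ (length ws' + 2)))"
        by (intro mult_left_mono sum_list_le_length_mult bound) auto
      also have "\<dots> \<le> 1 / real n * (real L * (fact (L - 1) * real n ^ (length ws' + 2)))"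
        using length_loops[of l v ws'] by (intro mult_left_mono mult_right_mono) (auto simp: L_def)
      also have "\<dots> = (real L * fact (L - 1)) * real n ^ length ws"
        using n_pos by (simp add: ws power2_eq_square)
      also have "\<dots> \<le> fact (Suc L) * real n ^ length ws"
        by (intro mult_right_mono mult_fact_pred_le) auto
      finally show ?thesis by (simp add: ws L_def)
    qed
  qed
qed

text \<open>The constant in the covariance estimate: it depends on the total number of letters, but
  not on \<open>n\<close>.\<close>

definition cov_bound :: "nat \<Rightarrow> real" where
  "cov_bound L = real L * fact L"

text \<open>Apply the loop equation to the first trace. By induction the terms that leave
  \<open>w'\<close> alone recombine to the product of expectations. A merge with \<open>w'\<close>
  loses a trace instead of creating one, so with the factor \<open>1 / n\<close> it lies two powers
  of \<open>n\<close> below the main term.\<close>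

lemma EE_prtr_snoc_le:
  "idx (concat ws) \<subseteq> R \<Longrightarrow> idx w' \<subseteq> R \<Longrightarrow>
    EE (prtr n (ws @ [w'])) \<le> EE (prtr n ws) * EE (trw n w') +
      cov_bound (length (concat ws) + length w') * real n ^ length ws / real n"
proof (induction "length ws + length (concat ws)" arbitrary: ws rule: less_induct)
  case less
  show ?case
  proof (cases ws)
    case Nil
    then show ?thesis by (simp add: EE_def prob_space cov_bound_def)
  next
    case (Cons w ws')
    show ?thesis
    proof (cases w)
      case Nil
      have "EE (prtr n (ws' @ [w'])) \<le> EE (prtr n ws') * EE (trw n w') +
          cov_bound (length (concat ws') + length w') * real n ^ length ws' / real n"
        using less Cons Nil by auto
      then have "real n * EE (prtr n (ws' @ [w'])) \<le> real n * (EE (prtr n ws') * EE (trw n w') +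
          cov_bound (length (concat ws') + length w') * real n ^ length ws' / real n)"
        by (rule mult_left_mono) simp
      then show ?thesis by (simp add: Cons Nil EE_prtr_Nil algebra_simps)
    next
      case (Cons l v)
      note ws = \<open>ws = w # ws'\<close> \<open>w = l # v\<close>
      define L where "L = length v + length (concat ws') + length w'"
      define E where "E = EE (trw n w')"
      define N where "N = real n ^ Suc (length ws')"
      have N: "0 \<le> N" by (simp add: N_def)
      have len: "length (concat us) + length w' = L - 1" if "us \<in> set (loops l v ws')" for us
        using loops_props[OF that] unfolding L_def by linarith
      have b1: "EE (prtr n (us @ [w'])) \<le> EE (prtr n us) * E + real (Suc L) * fact (L - 1) * N"
        if us: "us \<in> set (loops l v ws')" for us
      proof -
        note p = loops_props[OF us]
        have "EE (prtr n (us @ [w'])) \<le> EE (prtr n us) * E +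
            cov_bound (L - 1) * real n ^ length us / real n"
          unfolding len[OF us, symmetric] E_def
          using p less(2,3) unfolding ws by (intro less(1)) (auto simp: ws)
        moreover have "cov_bound (L - 1) * real n ^ length us / real n \<le>
            cov_bound (L - 1) * real n ^ (length ws' + 2) / real n"
          using p n_pos by (intro divide_right_mono mult_left_mono power_increasing) (auto simp: cov_bound_def)
        moreover have "\<dots> = cov_bound (L - 1) * N" using n_pos by (simp add: N_def)
        moreover have "cov_bound (L - 1) * N \<le> real (Suc L) * fact (L - 1) * N"
          unfolding cov_bound_def using N by (intro mult_right_mono) auto
        ultimately show ?thesis by linarith
      qed
      have b2: "EE (prtr n (ws' @ [u])) \<le> real (Suc L) * fact (L - 1) * N"
        if u: "u \<in> set (merges l v w')" for u
      proof -
        note p = merges_props[OF u]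
        have "EE (prtr n (ws' @ [u])) \<le> fact (length (concat (ws' @ [u]))) * real n ^ length (ws' @ [u])"
          using p less(2,3) by (intro EE_prtr_le) (auto simp: ws)
        also have "length (concat (ws' @ [u])) = L - 1" using p by (simp add: L_def)
        also have "real n ^ length (ws' @ [u]) = N" by (simp add: N_def)
        also have "fact (L - 1) * N \<le> real (Suc L) * fact (L - 1) * N"
          using N by (intro mult_right_mono) auto
        finally show ?thesis .
      qed
      define S where "S = (\<Sum>us\<leftarrow>loops l v ws'. EE (prtr n us))"
      define B where "B = real (Suc L) * fact (L - 1) * N"
      have "(\<Sum>us\<leftarrow>loops l v ws'. EE (prtr n (us @ [w']))) \<le> (\<Sum>us\<leftarrow>loops l v ws'. EE (prtr n us) * E + B)"
        unfolding B_def by (rule sum_list_mono) (rule b1)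
      also have "\<dots> = S * E + real (length (loops l v ws')) * B"
        by (simp add: sum_list_addf sum_list_mult_const sum_list_triv S_def)
      finally have 1: "(\<Sum>us\<leftarrow>loops l v ws'. EE (prtr n (us @ [w']))) \<le> \<dots>" .
      have 2: "(\<Sum>u\<leftarrow>merges l v w'. EE (prtr n (ws' @ [u]))) \<le> real (length (merges l v w')) * B"
        unfolding B_def by (rule sum_list_le_length_mult) (rule b2)
      \<comment> \<open>Each term costs at most one \<open>B\<close>, either as an inherited error
        or as a merge, and both kinds together number at most \<open>L\<close>, the letters that
        remain besides \<open>l\<close>.\<close>
      have "real (length (loops l v ws') + length (merges l v w')) * B \<le> real L * B"
        using length_loops[of l v ws'] length_merges[of l v w'] N
        by (intro mult_right_mono) (auto simp: L_def B_def)
      also have "\<dots> = real (Suc L) * (real L * fact (L - 1)) * N" by (simp add: B_def)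
      also have "\<dots> \<le> real (Suc L) * fact (Suc L) * N"
        using N by (intro mult_right_mono mult_left_mono mult_fact_pred_le) auto
      finally have 3: "real (length (loops l v ws')) * B + real (length (merges l v w')) * B \<le>
          cov_bound (Suc L) * N"
        by (simp add: cov_bound_def distrib_right)
      have "EE (prtr n (ws @ [w'])) = 1 / real n * (\<Sum>us\<leftarrow>loops l v (ws' @ [w']). EE (prtr n us))"
        using less(2,3) unfolding ws append_Cons by (intro loop_equation) auto
      also have "(\<Sum>us\<leftarrow>loops l v (ws' @ [w']). EE (prtr n us)) =
          (\<Sum>us\<leftarrow>loops l v ws'. EE (prtr n (us @ [w']))) + (\<Sum>u\<leftarrow>merges l v w'. EE (prtr n (ws' @ [u])))"
        by (simp only: loops_append comp_def map_append sum_list.append map_map)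
      also have "1 / real n * \<dots> \<le> 1 / real n * (S * E + cov_bound (Suc L) * N)"
        using 1 2 3 by (intro mult_left_mono) auto
      also have "\<dots> = (1 / real n * S) * E + cov_bound (Suc L) * N / real n"
        by (simp add: add_divide_distrib)
      also have "1 / real n * S = EE (prtr n ws)"
        using less(2) unfolding ws S_def by (intro loop_equation[symmetric]) auto
      also have "cov_bound (Suc L) * N / real n =
          cov_bound (length (concat ws) + length w') * real n ^ length ws / real n"
        by (simp add: ws N_def L_def add_ac)
      finally show ?thesis unfolding E_def .
    qed
  qed
qed

text \<open>Two copies of one word: the variance of a trace stays bounded as \<open>n\<close>
  grows.\<close>

lemma EE_trw_square_le:
  assumes "idx w \<subseteq> R"
  shows "EE (\<lambda>x. trw n w x * trw n w x) \<le> EE (trw n w) * EE (trw n w) + cov_bound (2 * length w)"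
proof -
  have "prtr n ([w] @ [w]) = (\<lambda>x. trw n w x * trw n w x)" by auto
  then show ?thesis
    using EE_prtr_snoc_le[of "[w]" w] assms n_pos by (simp add: prtr_single mult_2)
qed

text \<open>Of the terms in the loop equation only the splits described by \<open>cut_Suc\<close>
  are kept; the others are nonnegative. Positive correlation then separates the two traces of each
  split.\<close>

lemma EE_trw_cut_Suc_ge:
  assumes "r < m" "{1..m} \<subseteq> R"
  shows "(\<Sum>a\<le>i. EE (trw n (cut m r a)) * EE (trw n (wpow (gram m) (i - a)))) / real n \<le> EE (trw n (cut m (Suc r) i))"
proof -
  define l where "l = (Suc r, True)"
  obtain w where w: "cut m (Suc r) i = l # w"
    unfolding l_def by (rule cut_Suc[OF assms(1), of 0 i]) auto
  \<comment> \<open>The contribution to the loop equation of pairing the first letter with position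
    \<open>p\<close> of \<open>w\<close>.\<close>
  define g where "g p = (\<Sum>us\<leftarrow>(if w ! p = opp l then [[take p w, drop (Suc p) w]]
     else if w ! p = l then [[take p w @ flip (drop (Suc p) w)]] else []). EE (prtr n us))" for p
  have idx: "insert (Suc r) (idx w) \<subseteq> R"
    using idx_cut[of "Suc r" m i] assms unfolding w l_def by auto
  have g_nonneg: "0 \<le> g p" for p
  proof -
    have "idx (concat us) \<subseteq> R" if "us \<in> {[take p w, drop (Suc p) w], [take p w @ flip (drop (Suc p) w)]}" for us
    proof -
      have "idx (take p w) \<subseteq> R" "idx (drop (Suc p) w) \<subseteq> R"
        using idx idx_take[of p w] idx_drop[of "Suc p" w] by blast+
      then show ?thesis using that by (elim insertE) (simp_all add: flip_simps)
    qed
    then show ?thesis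
      unfolding g_def by (intro sum_list_nonneg) (auto split: if_splits intro!: EE_prtr_nonneg simp del: concat.simps)
  qed
  have step: "length (cut m r a) < length w \<and>
      EE (trw n (cut m r a)) * EE (trw n (wpow (gram m) (i - a))) \<le> g (length (cut m r a))"
    if "a \<le> i" for a
  proof -
    obtain v where v: "cut m (Suc r) i = (Suc r, True) # cut m r a @ (Suc r, False) # v"
      "\<And>n x. trw n v x = trw n (wpow (gram m) (i - a)) x" "idx v \<subseteq> {1..m}"
      by (rule cut_Suc[OF assms(1) \<open>a \<le> i\<close>]) (rule that)
    then have wv: "w = cut m r a @ opp l # v" unfolding w by (simp add: l_def opp_def)
    have "trw n v = trw n (wpow (gram m) (i - a))" using v(2) by auto
    then have "EE (trw n (cut m r a)) * EE (trw n (wpow (gram m) (i - a))) =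
        EE (trw n (cut m r a)) * EE (trw n v)" by simp
    also have "\<dots> \<le> EE (\<lambda>x. trw n (cut m r a) x * trw n v x)"
      using idx_cut[of r m a] assms v(3) by (intro EE_mult_ge pos_poly_trw) auto
    also have "(\<lambda>x. trw n (cut m r a) x * trw n v x) = prtr n [cut m r a, v]" by auto
    also have "EE \<dots> = g (length (cut m r a))" by (simp add: g_def wv)
    finally show ?thesis by (simp add: wv)
  qed
  \<comment> \<open>Different \<open>a\<close> select different partners, so no split is counted
    twice.\<close>
  have inj: "inj_on (\<lambda>a. length (cut m r a)) {..i}"
    using assms(1) by (auto intro!: inj_onI simp: length_cut)
  have "(\<Sum>a\<le>i. EE (trw n (cut m r a)) * EE (trw n (wpow (gram m) (i - a)))) \<le>
      (\<Sum>a\<le>i. g (length (cut m r a)))"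
    using step by (intro sum_mono) auto
  also have "\<dots> = sum g ((\<lambda>a. length (cut m r a)) ` {..i})"
    by (simp add: sum.reindex[OF inj])
  also have "\<dots> \<le> sum g {..<length w}"
    using step g_nonneg by (intro sum_mono2) auto
  also have "\<dots> = (\<Sum>us\<leftarrow>loops l w []. EE (prtr n us))"
    unfolding loops_def splits_def mergeall.simps append_Nil2 map_ident sum_list_concat_map g_def
    by (simp add: interv_sum_list_conv_sum_set_nat atLeast0LessThan)
  finally have "(\<Sum>a\<le>i. EE (trw n (cut m r a)) * EE (trw n (wpow (gram m) (i - a)))) / real n \<le>
      1 / real n * (\<Sum>us\<leftarrow>loops l w []. EE (prtr n us))"
    by (simp add: divide_right_mono)
  also have "\<dots> = EE (prtr n [l # w])"
    using idx by (intro loop_equation[symmetric]) (auto simp: l_def)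
  finally show ?thesis by (simp add: w prtr_single)
qed

end

section \<open>The upper moment bound\<close>

lemma pd_power:
  assumes "pos_poly V f"
  shows "pd v (\<lambda>x. f x ^ k) = (\<lambda>x. real k * f x ^ (k - 1) * pd v f x)"
proof (cases k)
  case (Suc j)
  then show ?thesis by (simp only: pd_power_Suc[OF assms] diff_Suc_1)
qed (simp add: pd_const)

lemma ent_gram_pow_sym:
  "a < n \<Longrightarrow> b < n \<Longrightarrow> ent n (wpow (gram m) i) a b x = ent n (wpow (gram m) i) b a x"
  using ent_flip[of a n b "wpow (gram m) i" x] by (simp add: flip_wpow gram_def flip_simps)

section \<open>Moments of the auxiliary quadratic form\<close>

context gauss_mats
begin

text \<open>Here \<open>q\<close> is the squared norm of matrix \<open>r\<close> applied to a vector
  \<open>z\<close>, where \<open>z\<close> and \<open>H\<close> do not involve that matrix. One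
  integration by parts gives the chi-squared recursion: \<open>n\<close> comes from differentiating
  the linear factor, \<open>2 * k\<close> from differentiating \<open>q ^ k\<close>.\<close>

lemma EE_sq_norm_Suc:
  assumes r: "r \<in> R"
    and z: "\<And>b. b < n \<Longrightarrow> pos_poly (vars n (R - {r})) (z b)"
    and H: "pos_poly (vars n (R - {r})) H"
    and q: "q = (\<lambda>x. \<Sum>a<n. (\<Sum>b<n. x (r, a, b) * z b x)\<^sup>2)"
  shows "EE (\<lambda>x. q x ^ Suc k * H x) =
    (real n + 2 * real k) / real n * EE (\<lambda>x. q x ^ k * ((\<Sum>b<n. (z b x)\<^sup>2) * H x))"
proof -
  define y where "y a x = (\<Sum>b<n. x (r, a, b) * z b x)" for a x
  define Z where "Z x = (\<Sum>b<n. (z b x)\<^sup>2)" for x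
  have sub: "vars n (R - {r}) \<subseteq> vars n R" by (auto simp: vars_def)
  note ppz = z[THEN pos_poly_mono, OF _ sub] and ppH = H[THEN pos_poly_mono, OF sub]
  have ppv: "pos_poly (vars n R) (\<lambda>x. x (r, a, b))" if "a < n" "b < n" for a b
    using that r by (intro pos_poly.var) (auto simp: vars_def)
  have ppy: "pos_poly (vars n R) (y a)" if "a < n" for a
    unfolding y_def[abs_def] using that by (intro pos_poly_sum pos_poly.mult ppv ppz) auto
  have qy: "q = (\<lambda>x. \<Sum>a<n. (y a x)\<^sup>2)" by (simp add: q y_def)
  have ppq: "pos_poly (vars n R) q"
    unfolding qy by (intro pos_poly_sum pos_poly_power ppy) auto
  have pdz: "pd (r, a, b) (z c) = (\<lambda>x. 0)" if "c < n" for a b c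
    by (rule pd_notin[OF z[OF that]]) (auto simp: vars_def)
  have pdH: "pd (r, a, b) H = (\<lambda>x. 0)" for a b
    by (rule pd_notin[OF H]) (auto simp: vars_def)
  have pdy: "pd (r, a, b) (y c) x = of_bool (a = c) * z b x" if "a < n" "b < n" "c < n" for a b c x
  proof -
    have "pd (r, a, b) (y c) x = (\<Sum>d<n. pd (r, a, b) (\<lambda>x. x (r, c, d) * z d x) x)"
      unfolding y_def[abs_def] using that
      by (subst pd_sum[where V = "vars n R"]) (auto intro: pos_poly.mult ppv ppz)
    also have "\<dots> = (\<Sum>d<n. if d = b then of_bool (a = c) * z b x else 0)"
      using that by (intro sum.cong refl, subst pd_mult[OF ppv ppz]) (auto simp: pdz pd_var)
    finally show ?thesis using that by simp
  qed
  have pdq: "pd (r, a, b) q x = 2 * y a x * z b x" if "a < n" "b < n" for a b x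
  proof -
    have "pd (r, a, b) q x = (\<Sum>c<n. pd (r, a, b) (\<lambda>x. (y c x)\<^sup>2) x)"
      unfolding qy by (subst pd_sum[where V = "vars n R"]) (auto intro: pos_poly_power ppy)
    also have "\<dots> = (\<Sum>c<n. if c = a then 2 * y a x * z b x else 0)"
      using that by (intro sum.cong refl) (auto simp: pd_power[OF ppy] pdy)
    finally show ?thesis using that by simp
  qed
  have pp: "pos_poly (vars n R) (\<lambda>x. z b x * (y a x * (q x ^ k * H x)))" if "a < n" "b < n" for a b
    using that by (intro pos_poly.mult pos_poly_power ppz ppy ppq ppH)
  have pdp: "pd (r, a, b) (\<lambda>x. z b x * (y a x * (q x ^ k * H x))) x =
      (z b x)\<^sup>2 * (q x ^ k * H x) + 2 * real k * (y a x)\<^sup>2 * (z b x)\<^sup>2 * q x ^ (k - 1) * H x"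
    if "a < n" "b < n" for a b x
  proof -
    note pps = ppz[OF that(2)] ppy[OF that(1)] pos_poly_power[OF ppq, of k] ppH
    have "pd (r, a, b) (\<lambda>x. z b x * (y a x * (q x ^ k * H x))) x =
        z b x * (y a x * (real k * q x ^ (k - 1) * (2 * y a x * z b x) * H x) + z b x * (q x ^ k * H x))"
      using that
      by (simp add: pd_mult[OF pps(1) pos_poly.mult[OF pps(2) pos_poly.mult[OF pps(3,4)]]]
        pd_mult[OF pps(2) pos_poly.mult[OF pps(3,4)]] pd_mult[OF pps(3,4)] pdz pdH pdy pd_power[OF ppq] pdq)
    then show ?thesis by (simp add: algebra_simps power2_eq_square)
  qed
  have "EE (\<lambda>x. q x ^ Suc k * H x) =
      EE (\<lambda>x. \<Sum>a<n. \<Sum>b<n. x (r, a, b) * (z b x * (y a x * (q x ^ k * H x))))"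
  proof (rule arg_cong[where f = EE], rule ext)
    fix x
    have "q x ^ Suc k * H x = (\<Sum>a<n. y a x * y a x) * (q x ^ k * H x)"
      by (simp add: qy power2_eq_square)
    also have "\<dots> = (\<Sum>a<n. \<Sum>b<n. x (r, a, b) * (z b x * (y a x * (q x ^ k * H x))))"
      unfolding sum_distrib_right
    proof (intro sum.cong refl)
      fix a
      have "y a x * y a x * (q x ^ k * H x) = (\<Sum>b<n. x (r, a, b) * z b x) * (y a x * (q x ^ k * H x))"
        by (simp add: y_def mult.assoc)
      then show "y a x * y a x * (q x ^ k * H x) =
          (\<Sum>b<n. x (r, a, b) * (z b x * (y a x * (q x ^ k * H x))))"
        by (simp only: sum_distrib_right mult.assoc)
    qed
    finally show "q x ^ Suc k * H x = \<dots>" .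
  qed
  also have "\<dots> = (\<Sum>a<n. \<Sum>b<n. EE (\<lambda>x. x (r, a, b) * (z b x * (y a x * (q x ^ k * H x)))))"
    by (intro EE_sum2 pos_poly.mult[OF ppv] pp)
  also have "\<dots> = (\<Sum>a<n. \<Sum>b<n. 1 / real n * EE (pd (r, a, b) (\<lambda>x. z b x * (y a x * (q x ^ k * H x)))))"
    using r by (intro sum.cong refl ibp pp) (auto simp: vars_def)
  also have "\<dots> = 1 / real n * EE (\<lambda>x. \<Sum>a<n. \<Sum>b<n. pd (r, a, b) (\<lambda>x. z b x * (y a x * (q x ^ k * H x))) x)"
    by (subst EE_sum2) (auto intro!: pos_poly_pd pp simp: sum_distrib_left)
  also have "(\<lambda>x. \<Sum>a<n. \<Sum>b<n. pd (r, a, b) (\<lambda>x. z b x * (y a x * (q x ^ k * H x))) x) =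
      (\<lambda>x. (real n + 2 * real k) * (q x ^ k * (Z x * H x)))"
  proof
    fix x
    have "(\<Sum>a<n. \<Sum>b<n. pd (r, a, b) (\<lambda>x. z b x * (y a x * (q x ^ k * H x))) x) =
        (\<Sum>a<n. \<Sum>b<n. (z b x)\<^sup>2 * (q x ^ k * H x) + (y a x)\<^sup>2 * ((z b x)\<^sup>2 * (2 * real k * q x ^ (k - 1) * H x)))"
      by (intro sum.cong refl, subst pdp) (auto simp: mult_ac)
    also have "\<dots> = real n * (Z x * (q x ^ k * H x)) + q x * (Z x * (2 * real k * q x ^ (k - 1) * H x))"
      unfolding qy Z_def by (simp add: sum.distrib sum_distrib_left[symmetric] sum_distrib_right[symmetric])
    also have "\<dots> = (real n + 2 * real k) * (q x ^ k * (Z x * H x))"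
      by (cases k) (simp_all add: algebra_simps)
    finally show "(\<Sum>a<n. \<Sum>b<n. pd (r, a, b) (\<lambda>x. z b x * (y a x * (q x ^ k * H x))) x) = \<dots>" .
  qed
  finally show ?thesis by (simp add: EE_cmult Z_def)
qed

text \<open>The \<open>k\<close>-th moment of the squared norm of a vector of \<open>n\<close>
  independent centred Gaussians with variance \<open>1 / n\<close>.\<close>

definition chi :: "nat \<Rightarrow> real" where
  "chi k = (\<Prod>l<k. (real n + 2 * real l) / real n)"

text \<open>Column 0 of matrix \<open>Suc m\<close> plays the role of the auxiliary Gaussian vector \<open>g\<close>: \<open>colnorm m r\<close> is
  \<open>\<bar>W\<^bsub>r+1\<^esub> \<dots> W\<^sub>m g\<bar>\<^sup>2\<close>, and \<open>qform m i\<close> below is \<open>g\<^sup>T (P\<^sup>T P)\<^sup>i g\<close>.\<close>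

definition colnorm :: "nat \<Rightarrow> nat \<Rightarrow> (nat \<times> nat \<times> nat \<Rightarrow> real) \<Rightarrow> real" where
  "colnorm m r x = (\<Sum>a<n. (ent n (fwd r (Suc m)) a 0 x)\<^sup>2)"

text \<open>Factors of \<open>colnorm m r\<close> are exchanged one by one for factors of
  \<open>colnorm m (Suc r)\<close>; the extra power \<open>i\<close> collects those already
  exchanged.\<close>

lemma EE_colnorm_power_step:
  assumes "{1..Suc m} \<subseteq> R" "r \<le> m"
  shows "EE (\<lambda>x. colnorm m r x ^ k * colnorm m (Suc r) x ^ i) = chi k * EE (\<lambda>x. colnorm m (Suc r) x ^ (k + i))"
proof (induction k arbitrary: i)
  case 0
  then show ?case by (simp add: chi_def)
next
  case (Suc k)
  define z where "z b = ent n (fwd (Suc r) (Suc m)) b 0" for b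
  have r: "Suc r \<in> R" using assms by auto
  have sub: "{Suc (Suc r)..Suc m} \<subseteq> R - {Suc r}" using assms by auto
  have z: "pos_poly (vars n (R - {Suc r})) (z b)" if "b < n" for b
    unfolding z_def using that n_pos sub by (intro pos_poly_ent) (auto simp: idx_fwd)
  have Z: "colnorm m (Suc r) = (\<lambda>x. \<Sum>b<n. (z b x)\<^sup>2)"
    by (auto simp: colnorm_def z_def)
  have q: "colnorm m r = (\<lambda>x. \<Sum>a<n. (\<Sum>b<n. x (Suc r, a, b) * z b x)\<^sup>2)"
    using assms(2) by (auto simp: colnorm_def z_def fwd_Suc[of r "Suc m"] lvar_def)
  have H: "pos_poly (vars n (R - {Suc r})) (\<lambda>x. colnorm m (Suc r) x ^ i)"
    unfolding Z by (intro pos_poly_power pos_poly_sum z) auto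
  have "EE (\<lambda>x. colnorm m r x ^ Suc k * colnorm m (Suc r) x ^ i) =
      (real n + 2 * real k) / real n * EE (\<lambda>x. colnorm m r x ^ k * colnorm m (Suc r) x ^ Suc i)"
    using EE_sq_norm_Suc[OF r z H q, of k] by (simp add: fun_cong[OF Z, symmetric])
  also have "\<dots> = chi (Suc k) * EE (\<lambda>x. colnorm m (Suc r) x ^ (Suc k + i))"
    unfolding Suc by (simp add: chi_def)
  finally show ?case .
qed

text \<open>Here \<open>d\<close> counts the matrices in the product. For \<open>d = 0\<close> what
  remains is column 0 of the identity, with norm 1, and each further matrix contributes one factor
  \<open>chi k\<close>.\<close>

lemma EE_colnorm_power:
  assumes "{1..Suc m} \<subseteq> R" "d \<le> Suc m"
  shows "EE (\<lambda>x. colnorm m (Suc m - d) x ^ k) = chi k ^ d"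
  using assms(2)
proof (induction d)
  case 0
  have "colnorm m (Suc m) = (\<lambda>x. 1)"
  proof
    fix x
    have "colnorm m (Suc m) x = (\<Sum>a<n. if a = 0 then 1 else 0)"
      unfolding colnorm_def fwd_refl by (intro sum.cong) auto
    also have "\<dots> = 1" using n_pos by (subst sum.delta) auto
    finally show "colnorm m (Suc m) x = 1" .
  qed
  then show ?case by simp
next
  case (Suc d)
  have "Suc (Suc m - Suc d) = Suc m - d" using Suc.prems by simp
  then show ?case
    using EE_colnorm_power_step[OF assms(1), of "Suc m - Suc d" k 0] Suc by simp
qed

definition qform :: "nat \<Rightarrow> nat \<Rightarrow> (nat \<times> nat \<times> nat \<Rightarrow> real) \<Rightarrow> real" where
  "qform m i x = (\<Sum>a<n. x (Suc m, a, 0) * (\<Sum>c<n. ent n (wpow (gram m) i) a c x * x (Suc m, c, 0)))"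

lemma colnorm_0: "colnorm m 0 = qform m 1"
proof
  fix x
  have 0: "0 < n" using n_pos by simp
  define e where "e = ent n [(Suc m, False)]"
  have e: "e a 0 x = x (Suc m, a, 0)" for a
  proof -
    have "e a 0 x = (\<Sum>c<n. if c = 0 then x (Suc m, a, 0) else 0)"
      by (auto simp: e_def lvar_def intro!: sum.cong)
    then show ?thesis using 0 by simp
  qed
  have col: "ent n (fwd 0 (Suc m)) b 0 x = (\<Sum>c<n. ent n (fwd 0 m) b c x * x (Suc m, c, 0))"
    if "b < n" for b
    using that by (subst fwd_Suc', simp, subst ent_append) (auto simp: e[unfolded e_def] simp del: ent.simps)
  have "qform m 1 x = (\<Sum>a<n. \<Sum>c<n. \<Sum>b<n.
      (ent n (fwd 0 m) b a x * x (Suc m, a, 0)) * (ent n (fwd 0 m) b c x * x (Suc m, c, 0)))"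
    unfolding qform_def
    by (auto simp: gram_def ent_append ent_flip sum_distrib_left sum_distrib_right mult_ac intro!: sum.cong)
  also have "\<dots> = (\<Sum>b<n. \<Sum>a<n. \<Sum>c<n.
      (ent n (fwd 0 m) b a x * x (Suc m, a, 0)) * (ent n (fwd 0 m) b c x * x (Suc m, c, 0)))"
    by (rule sum_swap_inner)
  also have "\<dots> = colnorm m 0 x"
    unfolding colnorm_def by (auto simp: col power2_eq_square sum_product intro!: sum.cong)
  finally show "colnorm m 0 x = qform m 1 x" ..
qed

text \<open>Integrate by parts in the first copy of \<open>g\<close> in the form
  \<open>g^T A^i g\<close>, where \<open>A\<close> is the Gram matrix. Differentiating the second
  copy yields the trace; differentiating a factor \<open>g^T A g\<close> yields
  \<open>2 A g\<close>, hence a form with exponent \<open>i + 1\<close>. For \<open>l = 0\<close>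
  the truncated exponent has coefficient zero.\<close>

lemma EE_qform_step:
  assumes "{1..Suc m} \<subseteq> R"
  shows "EE (\<lambda>x. qform m i x * qform m 1 x ^ l) =
    (EE (\<lambda>x. trw n (wpow (gram m) i) x * qform m 1 x ^ l) +
      2 * real l * EE (\<lambda>x. qform m (Suc i) x * qform m 1 x ^ (l - 1))) / real n"
proof -
  define g where "g a x = (x (Suc m, a, 0) :: real)" for a :: nat and x :: "nat \<times> nat \<times> nat \<Rightarrow> real"
  define h where "h i a x = (\<Sum>c<n. ent n (wpow (gram m) i) a c x * g c x)" for i a x
  have q: "qform m i = (\<lambda>x. \<Sum>a<n. g a x * h i a x)" for i
    by (auto simp: qform_def h_def g_def)
  have "{1..m} \<subseteq> R" using assms by auto
  then have sub: "idx (wpow (gram m) i) \<subseteq> R" and sub': "idx (wpow (gram m) i) \<subseteq> R - {Suc m}" for i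
    using idx_wpow[of "gram m" i] by (auto simp: idx_gram subset_iff)
  have ppe: "pos_poly (vars n R) (ent n (wpow (gram m) i) a b)" if "a < n" "b < n" for i a b
    using that sub by (intro pos_poly_ent)
  have gv: "(Suc m, a, 0) \<in> vars n R" if "a < n" for a
    using that assms n_pos by (auto simp: vars_def)
  have ppg: "pos_poly (vars n R) (g a)" if "a < n" for a
    unfolding g_def[abs_def] using gv that by (intro pos_poly.var)
  have pph: "pos_poly (vars n R) (h i a)" if "a < n" for i a
    unfolding h_def[abs_def] using that by (intro pos_poly_sum pos_poly.mult ppe ppg) auto
  have ppq: "pos_poly (vars n R) (qform m i)" for i
    unfolding q by (intro pos_poly_sum pos_poly.mult ppg pph) auto
  have pde: "pd (Suc m, a, 0) (ent n (wpow (gram m) i) c d) = (\<lambda>x. 0)" if "c < n" "d < n" for a i c d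
    by (rule pd_notin[OF pos_poly_ent[OF sub' that]]) (auto simp: vars_def)
  have pdg: "pd (Suc m, a, 0) (g c) x = of_bool (a = c)" for a c x
    unfolding g_def[abs_def] by (auto simp: pd_var)
  have pdh: "pd (Suc m, a, 0) (h i c) x = ent n (wpow (gram m) i) c a x" if "a < n" "c < n" for a i c x
  proof -
    have "pd (Suc m, a, 0) (h i c) x = (\<Sum>d<n. pd (Suc m, a, 0) (\<lambda>x. ent n (wpow (gram m) i) c d x * g d x) x)"
      unfolding h_def[abs_def] using that
      by (subst pd_sum[where V = "vars n R"]) (auto intro: pos_poly.mult ppe ppg)
    also have "\<dots> = (\<Sum>d<n. if d = a then ent n (wpow (gram m) i) c a x else 0)"
      using that by (intro sum.cong refl, subst pd_mult[OF ppe ppg]) (auto simp: pde pdg)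
    finally show ?thesis using that by simp
  qed
  have pdq: "pd (Suc m, a, 0) (qform m 1) x = 2 * h 1 a x" if "a < n" for a x
  proof -
    have "pd (Suc m, a, 0) (qform m 1) x = (\<Sum>c<n. pd (Suc m, a, 0) (\<lambda>x. g c x * h 1 c x) x)"
      unfolding q by (subst pd_sum[where V = "vars n R"]) (auto intro: pos_poly.mult pph ppg)
    also have "\<dots> = (\<Sum>c<n. ent n (wpow (gram m) 1) a c x * g c x + (if c = a then h 1 a x else 0))"
    proof (intro sum.cong refl)
      fix c assume "c \<in> {..<n}"
      then have c: "c < n" by simp
      show "pd (Suc m, a, 0) (\<lambda>x. g c x * h 1 c x) x =
          ent n (wpow (gram m) 1) a c x * g c x + (if c = a then h 1 a x else 0)"
        unfolding pd_mult[OF ppg[OF c] pph[OF c]] pdg pdh[OF that c] ent_gram_pow_sym[OF that c] by simp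
    qed
    finally show ?thesis using that by (simp add: sum.distrib h_def)
  qed
  have hh: "(\<Sum>a<n. h i a x * h 1 a x) = qform m (Suc i) x" for x
  proof -
    have "(\<Sum>a<n. h i a x * h 1 a x) = (\<Sum>a<n. \<Sum>c<n. \<Sum>d<n.
        (ent n (wpow (gram m) i) c a x * g c x) * (ent n (wpow (gram m) 1) a d x * g d x))"
      unfolding h_def sum_product by (intro sum.cong refl) (simp add: ent_gram_pow_sym)
    also have "\<dots> = (\<Sum>c<n. \<Sum>d<n. \<Sum>a<n.
        (ent n (wpow (gram m) i) c a x * g c x) * (ent n (wpow (gram m) 1) a d x * g d x))"
      by (rule sum_swap_inner[symmetric])
    also have "\<dots> = qform m (Suc i) x"
      unfolding q h_def wpow_Suc'
      by (auto simp: ent_append sum_distrib_left sum_distrib_right mult_ac intro!: sum.cong)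
    finally show ?thesis .
  qed
  have pp: "pos_poly (vars n R) (\<lambda>x. h i a x * qform m 1 x ^ l)" if "a < n" for a
    using that by (intro pos_poly.mult pph pos_poly_power ppq)
  have "EE (\<lambda>x. qform m i x * qform m 1 x ^ l) = EE (\<lambda>x. \<Sum>a<n. x (Suc m, a, 0) * (h i a x * qform m 1 x ^ l))"
    unfolding q[of i] by (simp add: g_def sum_distrib_right mult.assoc)
  also have "\<dots> = (\<Sum>a<n. EE (\<lambda>x. x (Suc m, a, 0) * (h i a x * qform m 1 x ^ l)))"
    by (intro EE_sum pos_poly.mult pos_poly.var gv pp) auto
  also have "\<dots> = (\<Sum>a<n. 1 / real n * EE (pd (Suc m, a, 0) (\<lambda>x. h i a x * qform m 1 x ^ l)))"
    by (intro sum.cong refl ibp pp gv) auto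
  also have "\<dots> = EE (\<lambda>x. \<Sum>a<n. pd (Suc m, a, 0) (\<lambda>x. h i a x * qform m 1 x ^ l) x) / real n"
    by (subst EE_sum) (auto intro!: pos_poly_pd pp simp: sum_divide_distrib simp del: One_nat_def)
  also have "(\<lambda>x. \<Sum>a<n. pd (Suc m, a, 0) (\<lambda>x. h i a x * qform m 1 x ^ l) x) =
      (\<lambda>x. trw n (wpow (gram m) i) x * qform m 1 x ^ l +
        2 * real l * (qform m (Suc i) x * qform m 1 x ^ (l - 1)))"
  proof
    fix x
    have "(\<Sum>a<n. pd (Suc m, a, 0) (\<lambda>x. h i a x * qform m 1 x ^ l) x) =
        (\<Sum>a<n. ent n (wpow (gram m) i) a a x * qform m 1 x ^ l +
          h i a x * h 1 a x * (2 * real l * qform m 1 x ^ (l - 1)))"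
    proof (intro sum.cong refl)
      fix a assume "a \<in> {..<n}"
      then have a: "a < n" by simp
      show "pd (Suc m, a, 0) (\<lambda>x. h i a x * qform m 1 x ^ l) x = ent n (wpow (gram m) i) a a x * qform m 1 x ^ l +
          h i a x * h 1 a x * (2 * real l * qform m 1 x ^ (l - 1))"
        unfolding pd_mult[OF pph[OF a] pos_poly_power[OF ppq]] pd_power[OF ppq] pdq[OF a] pdh[OF a a]
        by simp
    qed
    also have "\<dots> = trw n (wpow (gram m) i) x * qform m 1 x ^ l +
        2 * real l * (qform m (Suc i) x * qform m 1 x ^ (l - 1))"
      by (simp add: sum.distrib trw_def sum_distrib_right[symmetric] hh del: One_nat_def)
    finally show "(\<Sum>a<n. pd (Suc m, a, 0) (\<lambda>x. h i a x * qform m 1 x ^ l) x) = \<dots>" .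
  qed
  also have "EE \<dots> = EE (\<lambda>x. trw n (wpow (gram m) i) x * qform m 1 x ^ l) +
      2 * real l * EE (\<lambda>x. qform m (Suc i) x * qform m 1 x ^ (l - 1))"
    unfolding EE_cmult[symmetric]
    by (intro EE_add pos_poly.mult pos_poly.const pos_poly_power ppq pos_poly_trw sub) auto
  finally show ?thesis .
qed

lemma pos_poly_qform:
  assumes "{1..Suc m} \<subseteq> R"
  shows "pos_poly (vars n R) (qform m i)"
proof -
  have "idx (wpow (gram m) i) \<subseteq> R"
    using idx_wpow[of "gram m" i] assms by (auto simp: idx_gram subset_iff)
  then show ?thesis
    unfolding qform_def[abs_def] using assms n_pos
    by (intro pos_poly_sum pos_poly.mult pos_poly.var pos_poly_ent) (auto simp: vars_def)
qed

text \<open>Dropping the trace term of \<open>EE_qform_step\<close> gives \<open>ineq1\<close>,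
  which raises the exponent of the form while using up powers of \<open>q\<close>. Dropping the
  other term and using positive correlation gives \<open>ineq2\<close>, which splits off the trace
  moment. Since \<open>N k\<close> and \<open>N (k - j)\<close> are explicit, their ratio is the
  numerator of the product.\<close>

theorem EE_trace_gram_power_le:
  assumes R: "{1..Suc m} \<subseteq> R" and j: "1 \<le> j" "j \<le> k"
  shows "EE (trw n (wpow (gram m) j)) \<le>
    2 * real k * (\<Prod>l\<in>{k-j..<k}. ((real n + 2 * real l) / real n) ^ Suc m / (2 * real (Suc l) / real n))"
proof -
  define N where "N k = EE (\<lambda>x. qform m 1 x ^ k)" for k
  define P where "P j = (\<Prod>l\<in>{k-j..<k}. 2 * real (Suc l) / real n)" for j
  note ppq = pos_poly_qform[OF R]
  have "idx (gram m) \<subseteq> R" using R by (auto simp: idx_gram)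
  then have sub: "idx (wpow (gram m) i) \<subseteq> R" for i using idx_wpow by blast
  have N: "N k = chi k ^ Suc m" for k
    using EE_colnorm_power[OF R, of "Suc m" k] by (simp add: N_def colnorm_0)
  have chi_pos: "0 < chi k" for k
    unfolding chi_def using n_pos by (intro prod_pos) auto
  have ineq1: "2 * real l / real n * EE (\<lambda>x. qform m (Suc i) x * qform m 1 x ^ (l - 1)) \<le>
      EE (\<lambda>x. qform m i x * qform m 1 x ^ l)" for i l
  proof -
    have "0 \<le> EE (\<lambda>x. trw n (wpow (gram m) i) x * qform m 1 x ^ l)"
      by (intro EE_nonneg pos_poly.mult pos_poly_power ppq pos_poly_trw sub)
    then show ?thesis by (subst EE_qform_step[OF R, of i l]) (simp add: divide_right_mono)
  qed
  have ineq2: "EE (trw n (wpow (gram m) i)) * N l / real n \<le> EE (\<lambda>x. qform m i x * qform m 1 x ^ l)" for i l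
  proof -
    have "EE (trw n (wpow (gram m) i)) * N l \<le> EE (\<lambda>x. trw n (wpow (gram m) i) x * qform m 1 x ^ l)"
      unfolding N_def by (intro EE_mult_ge pos_poly_power ppq pos_poly_trw sub)
    moreover have "0 \<le> EE (\<lambda>x. qform m (Suc i) x * qform m 1 x ^ (l - 1))"
      by (intro EE_nonneg pos_poly.mult pos_poly_power ppq)
    ultimately show ?thesis by (subst EE_qform_step[OF R]) (intro divide_right_mono add_increasing2 mult_nonneg_nonneg, auto)
  qed
  \<comment> \<open>For \<open>j = 1\<close> this is an equality: the factor
    \<open>2 * k / n\<close> stands on both sides. Including it gives \<open>P j\<close> the same
    index range as the ratio of \<open>N k\<close> and \<open>N (k - j)\<close>.\<close>
  have step: "1 \<le> j \<Longrightarrow> j \<le> k \<Longrightarrow>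
      P j * EE (\<lambda>x. qform m j x * qform m 1 x ^ (k - j)) \<le> 2 * real k / real n * N k" for j
  proof (induction j)
    case (Suc j)
    show ?case
    proof (cases "j = 0")
      case True
      then have "{k - Suc j..<k} = {k - 1}" using Suc by auto
      then have "P (Suc j) = 2 * real k / real n" using Suc True by (simp add: P_def)
      moreover have "(\<lambda>x. qform m 1 x * qform m 1 x ^ (k - 1)) = (\<lambda>x. qform m 1 x ^ k)"
        using Suc True by (simp add: power_eq_if)
      ultimately show ?thesis by (simp add: True N_def)
    next
      case False
      have "{k - Suc j..<k} = insert (k - Suc j) {k - j..<k}" using Suc by auto
      then have "P (Suc j) = (2 * real (Suc (k - Suc j)) / real n) * P j"
        unfolding P_def by (subst \<open>{k - Suc j..<k} = _\<close>, subst prod.insert) (use Suc in auto)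
      also have "Suc (k - Suc j) = k - j" using Suc by simp
      finally have "P (Suc j) * EE (\<lambda>x. qform m (Suc j) x * qform m 1 x ^ (k - Suc j)) =
          P j * (2 * real (k - j) / real n * EE (\<lambda>x. qform m (Suc j) x * qform m 1 x ^ (k - j - 1)))"
        by simp
      also have "\<dots> \<le> P j * EE (\<lambda>x. qform m j x * qform m 1 x ^ (k - j))"
        using ineq1[of "k - j" j] by (intro mult_left_mono) (auto simp: P_def intro!: prod_nonneg)
      also have "\<dots> \<le> 2 * real k / real n * N k" using Suc False by simp
      finally show ?thesis .
    qed
  qed simp
  have Ppos: "0 < P j" unfolding P_def using n_pos by (intro prod_pos) auto
  have "P j * (EE (trw n (wpow (gram m) j)) * N (k - j) / real n) \<le>
      P j * EE (\<lambda>x. qform m j x * qform m 1 x ^ (k - j))"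
    using Ppos by (intro mult_left_mono ineq2) auto
  also have "\<dots> \<le> 2 * real k / real n * N k" using step j by simp
  finally have main: "P j * EE (trw n (wpow (gram m) j)) * N (k - j) \<le> 2 * real k * N k"
    using n_pos by (simp add: divide_le_cancel)
  have "chi k = chi (k - j) * (\<Prod>l\<in>{k-j..<k}. (real n + 2 * real l) / real n)"
    unfolding chi_def lessThan_atLeast0 by (rule prod.atLeastLessThan_concat[symmetric]) auto
  then have "N k = N (k - j) * (\<Prod>l\<in>{k-j..<k}. ((real n + 2 * real l) / real n) ^ Suc m)"
    unfolding N by (simp only: power_mult_distrib prod_power_distrib)
  with main have "P j * EE (trw n (wpow (gram m) j)) * N (k - j) \<le>
      2 * real k * (\<Prod>l\<in>{k-j..<k}. ((real n + 2 * real l) / real n) ^ Suc m) * N (k - j)"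
    by (simp only: mult_ac)
  then have "P j * EE (trw n (wpow (gram m) j)) \<le>
      2 * real k * (\<Prod>l\<in>{k-j..<k}. ((real n + 2 * real l) / real n) ^ Suc m)"
    by (rule mult_right_le_imp_le) (simp add: N chi_pos del: power_Suc)
  then have "EE (trw n (wpow (gram m) j)) \<le>
      2 * real k * (\<Prod>l\<in>{k-j..<k}. ((real n + 2 * real l) / real n) ^ Suc m) / P j"
    using Ppos by (simp add: pos_le_divide_eq mult.commute del: power_Suc)
  then show ?thesis unfolding P_def by (simp only: prod_dividef times_divide_eq_right)
qed

end

section \<open>Gaussian models and asymptotics\<close>

definition gmoment :: "real \<Rightarrow> nat \<Rightarrow> real" where
  "gmoment \<sigma> k = (\<integral>x. normal_density 0 \<sigma> x * x ^ k \<partial>lborel)"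

text \<open>Read off from the closed form of the even moments and the vanishing of the odd ones; for
  \<open>k = 0\<close> both sides are zero.\<close>

lemma gmoment_Suc:
  assumes "0 < \<sigma>"
  shows "gmoment \<sigma> (Suc k) = \<sigma>\<^sup>2 * (real k * gmoment \<sigma> (k - 1))"
proof (cases "even k")
  case True
  then obtain j where j: "k = 2 * j" by (elim evenE)
  have odd: "gmoment \<sigma> (2 * i + 1) = 0" for i
    using integral_normal_moment_odd[OF assms, of 0 i] by (simp add: gmoment_def)
  show ?thesis
  proof (cases j)
    case 0
    then show ?thesis using odd[of 0] j by simp
  next
    case (Suc i)
    then have "k - 1 = 2 * i + 1" "Suc k = 2 * j + 1" using j by simp_all
    then show ?thesis by (simp only: odd mult_zero_right)
  qed
next
  case False
  then obtain j where j: "k = 2 * j + 1" by (elim oddE)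
  have even: "gmoment \<sigma> (2 * i) = fact (2 * i) * (\<sigma>\<^sup>2 / 2) ^ i / fact i" for i
    using integral_normal_moment_even[OF assms, of 0 i]
    by (simp add: gmoment_def power_divide)
  have "gmoment \<sigma> (2 * Suc j) = (\<sigma>\<^sup>2 / 2) * ((2 * real j + 2) * (2 * real j + 1) / (real j + 1)) *
      (fact (2 * j) * (\<sigma>\<^sup>2 / 2) ^ j / fact j)"
    unfolding even by (simp add: field_simps)
  also have "(2 * real j + 2) * (2 * real j + 1) / (real j + 1) = 2 * (2 * real j + 1)"
    by (simp add: field_simps)
  also have "\<sigma>\<^sup>2 / 2 * (2 * (2 * real j + 1)) * (fact (2 * j) * (\<sigma>\<^sup>2 / 2) ^ j / fact j) =
      \<sigma>\<^sup>2 * ((2 * real j + 1) * gmoment \<sigma> (2 * j))"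
    unfolding even by (simp only: mult.assoc) simp
  finally show ?thesis using j by (simp add: mult.commute)
qed

lemma mon_conv_prod:
  assumes "finite V" "set_mset \<mu> \<subseteq> V"
  shows "mon \<mu> x = (\<Prod>v\<in>V. x v ^ count \<mu> v)"
proof -
  have "mon \<mu> x = (\<Prod>v\<in>set_mset \<mu>. x v ^ count \<mu> v)"
    unfolding mon_def by (rule image_prod_mset_multiplicity)
  also have "\<dots> = (\<Prod>v\<in>V. x v ^ count \<mu> v)"
    using assms by (intro prod.mono_neutral_left) (auto simp: not_in_iff)
  finally show ?thesis .
qed

text \<open>When joint moments factor over the variables, Wick's rule at \<open>v\<close> concerns
  the factor of \<open>v\<close> only and reduces to \<open>gmoment_Suc\<close>; the remaining
  factors \<open>P\<close> are common to both sides.\<close>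

lemma gauss_familyI:
  assumes "prob_space M" "finite V" "0 < \<sigma>"
    and int: "\<And>c :: 'v \<Rightarrow> nat. integrable M (\<lambda>\<omega>. \<Prod>v\<in>V. X v \<omega> ^ c v)"
    and moment: "\<And>c :: 'v \<Rightarrow> nat. (\<integral>\<omega>. (\<Prod>v\<in>V. X v \<omega> ^ c v) \<partial>M) = (\<Prod>v\<in>V. gmoment \<sigma> (c v))"
  shows "gauss_family M X V (\<sigma>\<^sup>2)"
proof -
  interpret prob_space M by fact
  have mon: "(\<lambda>\<omega>. mon \<mu> (\<lambda>v. X v \<omega>)) = (\<lambda>\<omega>. \<Prod>v\<in>V. X v \<omega> ^ count \<mu> v)" if "set_mset \<mu> \<subseteq> V" for \<mu>
    by (simp add: mon_conv_prod[OF assms(2) that])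
  show ?thesis
  proof
    fix v \<mu> assume v: "v \<in> V" and \<mu>: "set_mset \<mu> \<subseteq> V"
    then have \<mu>': "set_mset (add_mset v \<mu>) \<subseteq> V" "set_mset (\<mu> - {#v#}) \<subseteq> V" by (auto dest: in_diffD)
    define P where "P = (\<Prod>w\<in>V - {v}. gmoment \<sigma> (count \<mu> w))"
    have "expectation (\<lambda>\<omega>. mon (add_mset v \<mu>) (\<lambda>v. X v \<omega>)) = gmoment \<sigma> (Suc (count \<mu> v)) * P"
      unfolding mon[OF \<mu>'(1)] moment P_def
      by (subst prod.remove[OF assms(2) v]) (auto intro!: arg_cong2[where f = "(*)"] prod.cong split: if_splits)
    moreover have "expectation (\<lambda>\<omega>. mon (\<mu> - {#v#}) (\<lambda>v. X v \<omega>)) = gmoment \<sigma> (count \<mu> v - 1) * P"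
      unfolding mon[OF \<mu>'(2)] moment P_def
      by (subst prod.remove[OF assms(2) v]) (auto intro!: arg_cong2[where f = "(*)"] prod.cong split: if_splits)
    ultimately show "expectation (\<lambda>\<omega>. mon (add_mset v \<mu>) (\<lambda>v. X v \<omega>)) =
        \<sigma>\<^sup>2 * (real (count \<mu> v) * expectation (\<lambda>\<omega>. mon (\<mu> - {#v#}) (\<lambda>v. X v \<omega>)))"
      by (simp add: gmoment_Suc[OF assms(3)])
  qed (simp_all add: mon int)
qed

lemma gauss_matsI:
  assumes "gauss_family M X (vars n R) ((1 / sqrt (real n))\<^sup>2)" "1 \<le> n"
  shows "gauss_mats M X n R"
proof -
  have "(1 / sqrt (real n))\<^sup>2 = 1 / real n" by (simp add: power_divide)
  then show ?thesis
    using assms by (auto simp: gauss_mats_def gauss_words_def gauss_mats_axioms_def)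
qed

text \<open>The reference model on a product space. It provides expectations that depend on
  \<open>n\<close> alone, and room for the extra matrix that carries the auxiliary vector.\<close>

definition ginibre :: "nat \<Rightarrow> nat set \<Rightarrow> (nat \<times> nat \<times> nat \<Rightarrow> real) measure" where
  "ginibre n R = (\<Pi>\<^sub>M v\<in>vars n R. density lborel (normal_density 0 (1 / sqrt (real n))))"

lemma gauss_mats_ginibre:
  assumes "finite R" "1 \<le> n"
  shows "gauss_mats (ginibre n R) (\<lambda>v x. x v) n R"
proof (rule gauss_matsI[OF _ assms(2)], rule gauss_familyI)
  define \<sigma> where "\<sigma> = 1 / sqrt (real n)"
  define N where "N = density lborel (normal_density 0 \<sigma>)"
  have \<sigma>: "0 < \<sigma>" using assms by (simp add: \<sigma>_def)
  interpret N: prob_space N unfolding N_def by (rule prob_space_normal_density[OF \<sigma>])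
  interpret product_prob_space "\<lambda>_. N" by standard
  have fin: "finite (vars n R)" using assms by (simp add: vars_def)
  have int: "integrable N (\<lambda>x. x ^ k)" for k
    unfolding N_def using integrable_normal_moment[OF \<sigma>, of 0 k]
    by (subst integrable_density) (auto simp: normal_density_nonneg)
  have eq: "integral\<^sup>L N (\<lambda>x. x ^ k) = gmoment \<sigma> k" for k
    unfolding N_def gmoment_def by (subst integral_density) (auto simp: normal_density_nonneg)
  show "prob_space (ginibre n R)"
    unfolding ginibre_def by (intro prob_space_PiM) (metis N.prob_space_axioms N_def \<sigma>_def)
  show "finite (vars n R)" "0 < 1 / sqrt (real n)" using fin \<sigma> by (simp_all add: \<sigma>_def)
  show "integrable (ginibre n R) (\<lambda>x. \<Prod>v\<in>vars n R. x v ^ c v)" for c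
    unfolding ginibre_def \<sigma>_def[symmetric] N_def[symmetric] by (rule product_integrable_prod[OF fin int])
  show "(\<integral>x. (\<Prod>v\<in>vars n R. x v ^ c v) \<partial>ginibre n R) = (\<Prod>v\<in>vars n R. gmoment (1 / sqrt (real n)) (c v))" for c
    unfolding ginibre_def \<sigma>_def[symmetric] N_def[symmetric] product_integral_prod[OF fin int] eq ..
qed

text \<open>Independence enters at two levels: among the entries of one matrix, and among the
  matrices. Moments are factored at each level in turn.\<close>

lemma (in prob_space) gauss_mats_iid:
  assumes n: "1 \<le> n" and "finite R"
    and indep: "indep_vars (\<lambda>_. borel_mat n) Y R"
    and iid: "\<And>r. r \<in> R \<Longrightarrow> iid_gaussian_mat M n (1 / sqrt (real n)) (Y r)"
  shows "gauss_mats M (\<lambda>(r, a, b) \<omega>. Y r \<omega> $$ (a, b)) n R"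
proof (rule gauss_matsI[OF _ n], rule gauss_familyI)
  define \<sigma> where "\<sigma> = 1 / sqrt (real n)"
  have \<sigma>: "0 < \<sigma>" using assms by (simp add: \<sigma>_def)
  define I where "I = {..<n} \<times> {..<n}"
  have dist: "distributed M lborel (\<lambda>\<omega>. Y r \<omega> $$ p) (normal_density 0 \<sigma>)" if "r \<in> R" "p \<in> I" for r p
    using iid[OF that(1)] that(2) unfolding iid_gaussian_mat_def \<sigma>_def I_def by blast
  have int1: "integrable M (\<lambda>\<omega>. (Y r \<omega> $$ p) ^ k)" if "r \<in> R" "p \<in> I" for r p k
    using distributed_integrable[OF dist[OF that], of "\<lambda>x. x ^ k"] integrable_normal_moment[OF \<sigma>, of 0 k]
    by (simp add: normal_density_nonneg)
  have eq1: "expectation (\<lambda>\<omega>. (Y r \<omega> $$ p) ^ k) = gmoment \<sigma> k" if "r \<in> R" "p \<in> I" for r p k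
    using distributed_integral[OF dist[OF that], of "\<lambda>x. x ^ k"]
    by (simp add: normal_density_nonneg gmoment_def)
  \<comment> \<open>The part of a monomial that belongs to matrix \<open>r\<close>, written as a
    measurable function of that matrix so that independence of the matrices carries over.\<close>
  define F where "F c r A = (\<Prod>p\<in>I. (A $$ p) ^ c (r, p))" for c :: "nat \<times> nat \<times> nat \<Rightarrow> nat" and r and A :: "real mat"
  have indep1: "indep_vars (\<lambda>_. borel) (\<lambda>p \<omega>. (Y r \<omega> $$ p) ^ c (r, p)) I" if "r \<in> R" for r c
    using iid[OF that] unfolding iid_gaussian_mat_def I_def[symmetric]
    by (intro indep_vars_compose2[where Y = "\<lambda>p x. x ^ c (r, p)" and M' = "\<lambda>_. borel"]) auto
  have finI: "finite I" by (simp add: I_def)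
  have int2: "integrable M (\<lambda>\<omega>. F c r (Y r \<omega>))" if "r \<in> R" for r c
    unfolding F_def by (rule indep_vars_integrable[OF finI indep1 int1]) (use that in auto)
  have eq2: "expectation (\<lambda>\<omega>. F c r (Y r \<omega>)) = (\<Prod>p\<in>I. gmoment \<sigma> (c (r, p)))" if "r \<in> R" for r c
    unfolding F_def using that
    by (subst indep_vars_lebesgue_integral[OF finI indep1 int1]) (auto simp: eq1)
  have entry: "(\<lambda>A. A $$ p) \<in> borel_measurable (borel_mat n)" if "p \<in> I" for p
  proof -
    have "(\<lambda>A. \<lambda>p\<in>I. A $$ p) \<in> measurable (borel_mat n) (PiM I (\<lambda>_. borel :: real measure))"
      unfolding borel_mat_def I_def by (rule measurable_vimage_algebra1) (auto simp: space_PiM)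
    then have "(\<lambda>A. (\<lambda>p\<in>I. A $$ p) p) \<in> borel_measurable (borel_mat n)"
      by (rule measurable_compose[OF _ measurable_component_singleton[OF that]])
    then show ?thesis using that by simp
  qed
  have measF: "F c r \<in> borel_measurable (borel_mat n)" for c r
    unfolding F_def[abs_def] by (intro borel_measurable_prod borel_measurable_power entry)
  have indep2: "indep_vars (\<lambda>_. borel) (\<lambda>r \<omega>. F c r (Y r \<omega>)) R" for c
    by (rule indep_vars_compose2[OF indep measF])
  have prod: "(\<Prod>v\<in>vars n R. (case v of (r, a, b) \<Rightarrow> \<lambda>\<omega>. Y r \<omega> $$ (a, b)) \<omega> ^ c v) = (\<Prod>r\<in>R. F c r (Y r \<omega>))" for c \<omega>
    unfolding F_def vars_def I_def[symmetric] prod.cartesian_product by (intro prod.cong) auto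
  show "prob_space M" by (rule prob_space_axioms)
  show "finite (vars n R)" "0 < 1 / sqrt (real n)" using \<sigma> \<open>finite R\<close> by (simp_all add: \<sigma>_def vars_def)
  show "integrable M (\<lambda>\<omega>. \<Prod>v\<in>vars n R. (case v of (r, a, b) \<Rightarrow> \<lambda>\<omega>. Y r \<omega> $$ (a, b)) \<omega> ^ c v)" for c
    unfolding prod by (rule indep_vars_integrable[OF \<open>finite R\<close> indep2 int2])
  show "expectation (\<lambda>\<omega>. \<Prod>v\<in>vars n R. (case v of (r, a, b) \<Rightarrow> \<lambda>\<omega>. Y r \<omega> $$ (a, b)) \<omega> ^ c v) =
      (\<Prod>v\<in>vars n R. gmoment (1 / sqrt (real n)) (c v))" for c
  proof -
    have "expectation (\<lambda>\<omega>. \<Prod>v\<in>vars n R. (case v of (r, a, b) \<Rightarrow> \<lambda>\<omega>. Y r \<omega> $$ (a, b)) \<omega> ^ c v) =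
        (\<Prod>r\<in>R. expectation (\<lambda>\<omega>. F c r (Y r \<omega>)))"
      unfolding prod by (rule indep_vars_lebesgue_integral[OF \<open>finite R\<close> indep2 int2])
    also have "\<dots> = (\<Prod>r\<in>R. \<Prod>p\<in>I. gmoment \<sigma> (c (r, p)))"
      by (intro prod.cong refl eq2)
    also have "\<dots> = (\<Prod>v\<in>vars n R. gmoment (1 / sqrt (real n)) (c v))"
      by (simp add: vars_def I_def \<sigma>_def prod.cartesian_product)
    finally show ?thesis .
  qed
qed

section \<open>The lower bound for trace moments\<close>

lemma u_limit_mult_le:
  assumes "1 \<le> m" "0 \<le> G"
  shows "u_limit m * (G - 1) \<le> G ^ (m + 1)"
proof -
  \<comment> \<open>For \<open>G > 1\<close> the quotient \<open>G^(m+1) / (G - 1)\<close> has its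
    minimum \<open>u_limit m\<close> at \<open>G = (m + 1) / m\<close>. Rescaling moves this point
    to \<open>t = 1\<close>, where Bernoulli's inequality is the tangent line.\<close>
  define t where "t = real m / real (m + 1) * G"
  have "-1 \<le> t - 1" using assms by (simp add: t_def)
  from Bernoulli_inequality[OF this, of "m + 1"]
  have "1 + real (m + 1) * (t - 1) \<le> t ^ (m + 1)" by simp
  moreover have "1 + real (m + 1) * (t - 1) = real m * (G - 1)"
    using assms by (simp add: t_def field_simps)
  moreover have "t ^ (m + 1) = real m ^ (m + 1) / real (m + 1) ^ (m + 1) * G ^ (m + 1)"
    by (simp add: t_def power_mult_distrib power_divide)
  ultimately have "real m * (G - 1) \<le> real m ^ (m + 1) / real (m + 1) ^ (m + 1) * G ^ (m + 1)" by simp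
  then have "real (m + 1) ^ (m + 1) / real m ^ (m + 1) * (real m * (G - 1)) \<le>
      real (m + 1) ^ (m + 1) / real m ^ (m + 1) * (real m ^ (m + 1) / real (m + 1) ^ (m + 1) * G ^ (m + 1))"
    by (rule mult_left_mono) simp
  moreover have "real (m + 1) ^ (m + 1) / real m ^ (m + 1) * (real m * (G - 1)) = u_limit m * (G - 1)"
    using assms(1) by (simp add: u_limit_def)
  moreover have "real (m + 1) ^ (m + 1) / real m ^ (m + 1) * (real m ^ (m + 1) / real (m + 1) ^ (m + 1) * G ^ (m + 1)) =
      G ^ (m + 1)"
    using assms(1) by (simp del: of_nat_add power_Suc add: power_eq_0_iff)
  ultimately show ?thesis by linarith
qed

lemma u_limit_pos: "1 \<le> m \<Longrightarrow> 0 < u_limit m"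
  by (simp add: u_limit_def)

text \<open>Otherwise the generating functions \<open>S r\<close> converge at
  \<open>z = 1 / y'\<close>. The convolution bounds give \<open>S 0 ^ (m + 1) \<le> S m\<close>, and
  the shift gives \<open>z * S m = S 0 - 1\<close>. Together with \<open>u_limit_mult_le\<close>
  this forces \<open>u_limit m * z \<le> 1\<close>, although \<open>y' < u_limit m\<close>.\<close>

lemma superconvolution_growth:
  fixes \<alpha> :: "nat \<Rightarrow> nat \<Rightarrow> real"
  assumes m: "1 \<le> m" and y: "0 < y" "y < u_limit m"
    and nonneg: "\<And>r i. r \<le> m \<Longrightarrow> 0 \<le> \<alpha> r i"
    and conv: "\<And>r i. r < m \<Longrightarrow> (\<Sum>a\<le>i. \<alpha> r a * \<alpha> 0 (i - a)) \<le> \<alpha> (Suc r) i"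
    and shift: "\<And>i. \<alpha> m i = \<alpha> 0 (Suc i)" and one: "\<alpha> 0 0 = 1"
  shows "\<exists>i\<ge>1. y ^ i < \<alpha> 0 i"
proof (rule ccontr)
  assume "\<not> ?thesis"
  then have le: "\<alpha> 0 i \<le> y ^ i" for i using one by (cases "i = 0") (auto simp: not_less)
  \<comment> \<open>The gap above \<open>y\<close> gives geometric convergence, the gap below
    \<open>u_limit m\<close> gives the strict contradiction.\<close>
  obtain y' where y': "y < y'" "y' < u_limit m" using dense y(2) by blast
  define z where "z = 1 / y'"
  have z: "0 < z" "y * z < 1" using y y' by (auto simp: z_def)
  define S where "S r = (\<Sum>i. \<alpha> r i * z ^ i)" for r
  have term_nonneg: "0 \<le> \<alpha> r i * z ^ i" if "r \<le> m" for r i using nonneg[OF that] z by simp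
  have "summable (\<lambda>i. \<alpha> 0 i * z ^ i)"
  proof (rule summable_comparison_test')
    show "summable (\<lambda>i. (y * z) ^ i)" using z y by (intro summable_geometric) auto
    show "norm (\<alpha> 0 i * z ^ i) \<le> (y * z) ^ i" if "0 \<le> i" for i
      using le[of i] term_nonneg[of 0 i] z by (simp add: power_mult_distrib mult_right_mono)
  qed
  note sum0 = this
  have "summable (\<lambda>i. \<alpha> 0 (Suc i) * z ^ Suc i)"
    using sum0 by (subst summable_Suc_iff)
  then have "summable (\<lambda>i. (\<alpha> 0 (Suc i) * z ^ Suc i) / z)" by (rule summable_divide)
  then have summ: "summable (\<lambda>i. \<alpha> m i * z ^ i)" using z by (simp add: shift)
  \<comment> \<open>Convergence passes from \<open>r = m\<close> downwards: since
    \<open>\<alpha> 0 0 = 1\<close>, the last term of the convolution already shows that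
    \<open>\<alpha> r i \<le> \<alpha> (Suc r) i\<close>.\<close>
  have sums: "summable (\<lambda>i. \<alpha> (m - d) i * z ^ i)" if "d \<le> m" for d
    using that
  proof (induction d)
    case (Suc d)
    have "\<alpha> (m - Suc d) i \<le> \<alpha> (m - d) i" for i
    proof -
      have "\<alpha> (m - Suc d) i * \<alpha> 0 (i - i) \<le> (\<Sum>a\<le>i. \<alpha> (m - Suc d) a * \<alpha> 0 (i - a))"
        using nonneg by (intro member_le_sum) auto
      also have "\<dots> \<le> \<alpha> (Suc (m - Suc d)) i" using Suc.prems by (intro conv) auto
      also have "Suc (m - Suc d) = m - d" using Suc.prems by simp
      finally show ?thesis by (simp add: one)
    qed
    then show ?case
      using Suc z nonneg
      by (intro summable_comparison_test'[OF Suc.IH]) (auto simp: abs_mult intro!: mult_right_mono)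
  qed (use summ in simp)
  then have sums': "summable (\<lambda>i. \<alpha> r i * z ^ i)" if "r \<le> m" for r
    using sums[of "m - r"] that by simp
  have step: "S r * S 0 \<le> S (Suc r)" if "r < m" for r
  proof -
    have abs: "summable (\<lambda>i. norm (\<alpha> r i * z ^ i))" if "r \<le> m" for r
      using sums'[OF that] term_nonneg[OF that] by simp
    have r: "r \<le> m" using that by simp
    have "S r * S 0 = (\<Sum>k. \<Sum>i\<le>k. (\<alpha> r i * z ^ i) * (\<alpha> 0 (k - i) * z ^ (k - i)))"
      unfolding S_def using abs r by (intro Cauchy_product) auto
    also have "\<dots> \<le> S (Suc r)"
      unfolding S_def
    proof (rule suminf_le)
      show "summable (\<lambda>k. \<Sum>i\<le>k. (\<alpha> r i * z ^ i) * (\<alpha> 0 (k - i) * z ^ (k - i)))"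
        using abs r by (intro summable_Cauchy_product) auto
      show "summable (\<lambda>i. \<alpha> (Suc r) i * z ^ i)" using that by (intro sums') auto
      fix k
      have "(\<Sum>i\<le>k. (\<alpha> r i * z ^ i) * (\<alpha> 0 (k - i) * z ^ (k - i))) = (\<Sum>i\<le>k. \<alpha> r i * \<alpha> 0 (k - i)) * z ^ k"
        unfolding sum_distrib_right
        by (intro sum.cong) (auto simp: power_add[symmetric] mult_ac)
      also have "\<dots> \<le> \<alpha> (Suc r) k * z ^ k" using conv[OF that] z by (intro mult_right_mono) auto
      finally show "(\<Sum>i\<le>k. (\<alpha> r i * z ^ i) * (\<alpha> 0 (k - i) * z ^ (k - i))) \<le> \<alpha> (Suc r) k * z ^ k" .
    qed
    finally show ?thesis .
  qed
  have "1 \<le> S 0"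
  proof -
    have "(\<Sum>i<1. \<alpha> 0 i * z ^ i) \<le> S 0"
      unfolding S_def using term_nonneg[of 0] by (intro sum_le_suminf sum0) auto
    then show ?thesis by (simp add: one)
  qed
  have "S 0 ^ Suc r \<le> S r" if "r \<le> m" for r
    using that
  proof (induction r)
    case (Suc r)
    have "S 0 ^ Suc (Suc r) = S 0 ^ Suc r * S 0" by simp
    also have "\<dots> \<le> S r * S 0" using Suc \<open>1 \<le> S 0\<close> by (intro mult_right_mono) auto
    also have "\<dots> \<le> S (Suc r)" using Suc.prems by (intro step) auto
    finally show ?case .
  qed simp
  from this[of m] have "S 0 ^ (m + 1) \<le> S m" by simp
  moreover have "z * S m = S 0 - 1"
  proof -
    have "S 0 = \<alpha> 0 0 * z ^ 0 + (\<Sum>i. \<alpha> 0 (Suc i) * z ^ Suc i)"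
      unfolding S_def using suminf_split_head[OF sum0] by simp
    also have "(\<Sum>i. \<alpha> 0 (Suc i) * z ^ Suc i) = (\<Sum>i. z * (\<alpha> m i * z ^ i))"
      by (simp add: shift mult_ac)
    also have "\<dots> = z * S m"
      unfolding S_def by (rule suminf_mult[OF summ])
    finally show ?thesis by (simp add: one)
  qed
  ultimately have "z * S 0 ^ (m + 1) \<le> S 0 - 1" using z by (metis mult_left_mono less_imp_le)
  moreover have "u_limit m * (S 0 - 1) \<le> S 0 ^ (m + 1)" using \<open>1 \<le> S 0\<close> by (intro u_limit_mult_le m) auto
  ultimately have "u_limit m * (z * S 0 ^ (m + 1)) \<le> S 0 ^ (m + 1)"
    using u_limit_pos[OF m] by (meson less_imp_le mult_left_mono order_trans)
  then have "u_limit m * z * S 0 ^ (m + 1) \<le> 1 * S 0 ^ (m + 1)" by (simp only: mult.assoc mult_1)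
  moreover have "0 < S 0 ^ (m + 1)" using \<open>1 \<le> S 0\<close> by simp
  ultimately have "u_limit m * z \<le> 1" by (rule mult_right_le_imp_le)
  then show False using y y' by (simp add: z_def)
qed

text \<open>\<open>i\<close> and \<open>a\<close> must work for all \<open>n\<close> at once, with a
  strict gap \<open>y ^ i < a\<close> for Chebyshev's inequality later. They come from the reference
  model and are transferred by \<open>EE_eqI\<close>.\<close>

theorem trace_moment_lower:
  assumes m: "1 \<le> m" and y: "0 < y" "y < u_limit m"
  shows "\<exists>i\<ge>1. \<exists>a>y ^ i. \<forall>(M :: 'w measure) X n. gauss_mats M X n {1..m} \<longrightarrow>
    real n * a \<le> gauss_family.EE M X (trw n (wpow (gram m) i))"
proof -
  define E where "E n = gauss_family.EE (ginibre n {1..m}) (\<lambda>v x. x v)" for n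
  have G: "gauss_mats (ginibre n {1..m}) (\<lambda>v x. x v) n {1..m}" if "1 \<le> n" for n
    using that by (intro gauss_mats_ginibre) auto
  define \<tau> where "\<tau> r i n = E n (trw n (cut m r i)) / real n" for r i n
  \<comment> \<open>The infimum over \<open>n\<close> removes the dependence on \<open>n\<close>
    and, all terms being nonnegative, preserves the convolution inequality.\<close>
  define \<alpha> where "\<alpha> r i = (INF n\<in>{1..}. \<tau> r i n)" for r i
  have \<tau>_nonneg: "0 \<le> \<tau> r i n" if "r \<le> m" "1 \<le> n" for r i n
  proof -
    interpret gauss_mats "ginibre n {1..m}" "\<lambda>v x. x v" n "{1..m}" by (rule G[OF that(2)])
    show ?thesis
      unfolding \<tau>_def E_def using idx_cut[OF that(1)] by (intro divide_nonneg_nonneg EE_nonneg pos_poly_trw) auto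
  qed
  have bdd: "bdd_below (\<tau> r i ` {1..})" if "r \<le> m" for r i
    using \<tau>_nonneg[OF that] by (intro bdd_belowI[of _ 0]) auto
  have \<alpha>_le: "\<alpha> r i \<le> \<tau> r i n" if "r \<le> m" "1 \<le> n" for r i n
    unfolding \<alpha>_def using that by (intro cINF_lower bdd) auto
  have \<alpha>_nonneg: "0 \<le> \<alpha> r i" if "r \<le> m" for r i
    unfolding \<alpha>_def using \<tau>_nonneg[OF that] by (intro cINF_greatest) auto
  have eq0: "trw n (wpow (gram m) i) = trw n (cut m 0 i)" for n i
    by (rule ext) (simp add: trw_cut_0)
  have "\<exists>i\<ge>1. y ^ i < \<alpha> 0 i"
  proof (rule superconvolution_growth[OF m y])
    show "0 \<le> \<alpha> r i" if "r \<le> m" for r i by (rule \<alpha>_nonneg[OF that])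
    show "\<alpha> m i = \<alpha> 0 (Suc i)" for i
      by (simp add: \<alpha>_def \<tau>_def cut_self eq0[symmetric] del: wpow_simps)
    have "\<tau> 0 0 n = 1" if "1 \<le> n" for n
    proof -
      interpret gauss_mats "ginibre n {1..m}" "\<lambda>v x. x v" n "{1..m}" by (rule G[OF that])
      have "trw n (cut m 0 0) = (\<lambda>x. real n)" by (auto simp: eq0[symmetric] trw_Nil)
      then show ?thesis using that by (simp add: \<tau>_def E_def del: One_nat_def)
    qed
    then show "\<alpha> 0 0 = 1" unfolding \<alpha>_def by (subst INF_cong[OF refl, of _ _ "\<lambda>_. 1"]) auto
    show "(\<Sum>a\<le>i. \<alpha> r a * \<alpha> 0 (i - a)) \<le> \<alpha> (Suc r) i" if "r < m" for r i
      unfolding \<alpha>_def[of "Suc r"]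
    proof (rule cINF_greatest)
      fix n :: nat assume "n \<in> {1..}"
      then have n: "1 \<le> n" by simp
      interpret gauss_mats "ginibre n {1..m}" "\<lambda>v x. x v" n "{1..m}" by (rule G[OF n])
      have "(\<Sum>a\<le>i. \<alpha> r a * \<alpha> 0 (i - a)) \<le> (\<Sum>a\<le>i. \<tau> r a n * \<tau> 0 (i - a) n)"
        using n that by (intro sum_mono mult_mono \<alpha>_le \<alpha>_nonneg \<tau>_nonneg) auto
      also have "\<dots> = (\<Sum>a\<le>i. E n (trw n (cut m r a)) * E n (trw n (wpow (gram m) (i - a)))) / real n / real n"
        by (simp add: \<tau>_def eq0 sum_divide_distrib)
      also have "\<dots> \<le> \<tau> (Suc r) i n"
        unfolding \<tau>_def E_def using EE_trw_cut_Suc_ge[OF that subset_refl] by (intro divide_right_mono) auto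
      finally show "(\<Sum>a\<le>i. \<alpha> r a * \<alpha> 0 (i - a)) \<le> \<tau> (Suc r) i n" .
    qed auto
  qed
  then obtain i where i: "1 \<le> i" "y ^ i < \<alpha> 0 i" by auto
  have "real n * \<alpha> 0 i \<le> gauss_family.EE M X (trw n (wpow (gram m) i))"
    if "gauss_mats M X n {1..m}" for M :: "'w measure" and X n
  proof -
    interpret gauss_mats M X n "{1..m}" by fact
    interpret A: gauss_mats "ginibre n {1..m}" "\<lambda>v x. x v" n "{1..m}" by (rule G[OF n_pos])
    have "EE (trw n (wpow (gram m) i)) = A.EE (trw n (wpow (gram m) i))"
      by (rule EE_eqI[OF gauss_family_axioms A.gauss_family_axioms pos_poly_trw])
        (use idx_wpow[of "gram m" i] in \<open>auto simp: idx_gram\<close>)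
    moreover have "real n * \<alpha> 0 i \<le> A.EE (trw n (wpow (gram m) i))"
      using \<alpha>_le[of 0 n i] n_pos by (simp add: \<tau>_def E_def eq0 pos_le_divide_eq mult.commute)
    ultimately show ?thesis by simp
  qed
  with i show ?thesis by blast
qed

section \<open>The upper bound for trace moments\<close>

lemma upper_bound_asymp:
  assumes m: "1 \<le> m" and y: "u_limit m < y"
  shows "\<exists>j. \<forall>\<^sub>F n in sequentially. 1 \<le> j n \<and> (\<exists>k\<ge>j n. 2 * real k *
    (\<Prod>l\<in>{k-j n..<k}. ((real n + 2 * real l) / real n) ^ Suc m / (2 * real (Suc l) / real n)) \<le>
    y ^ j n / (real n)\<^sup>2)"
proof -
  define h where "h \<beta> = (1 + \<beta>) ^ (m + 1) / \<beta>" for \<beta> :: real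
  have h: "h (1 / real m) = u_limit m"
    using m by (simp add: h_def u_limit_def power_divide field_simps)
  obtain y' where y': "u_limit m < y'" "y' < y" using dense y by blast
  have "0 < y'" using u_limit_pos[OF m] y' by simp
  have "isCont h (1 / real m)"
    unfolding h_def using m by (intro continuous_intros) auto
  then have "(h \<longlongrightarrow> u_limit m) (at (1 / real m))" by (simp add: isCont_def h)
  then have "\<forall>\<^sub>F \<beta> in at (1 / real m). h \<beta> < y'" using y'(1) by (rule order_tendstoD)
  then obtain d where d: "0 < d" "\<And>\<beta>. \<beta> \<noteq> 1 / real m \<Longrightarrow> dist \<beta> (1 / real m) < d \<Longrightarrow> h \<beta> < y'"
    by (auto simp: eventually_at)
  then have hd: "h \<beta> < y'" if "dist \<beta> (1 / real m) < d" for \<beta>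
    using that y'(1) h by (cases "\<beta> = 1 / real m") auto
  \<comment> \<open>Of order \<open>sqrt n\<close>: long enough for \<open>\<rho> ^ j n\<close> to
    beat every power of \<open>n\<close>, and short enough for all factors to stay near the minimum
    of \<open>h\<close>.\<close>
  define j where "j n = nat \<lfloor>sqrt (real n)\<rfloor>" for n
  define k where "k n = n div (2 * m)" for n
  define \<rho> where "\<rho> = y' / y"
  have \<rho>: "0 < \<rho>" "\<rho> < 1" using \<open>0 < y'\<close> y' by (auto simp: \<rho>_def)
  \<comment> \<open>This absorbs the prefactor \<open>2 * K \<le> n\<close> and leaves the summable
    \<open>1 / n^2\<close>. The next two facts keep \<open>\<beta>\<close> within \<open>d\<close>
    of \<open>1 / m\<close> and ensure \<open>j n \<le> K\<close>.\<close>
  have "\<forall>\<^sub>F n in sequentially. real n * \<rho> powr (sqrt (real n) - 1) \<le> 1 / (real n)\<^sup>2"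
    using \<rho> by real_asymp
  moreover have "\<forall>\<^sub>F n in sequentially. 2 / real n + 2 * sqrt (real n) / real n < d"
    using d(1) by real_asymp
  moreover have "\<forall>\<^sub>F n in sequentially. sqrt (real n) + 1 \<le> real n / (2 * real m)"
    using m by real_asymp
  moreover have "\<forall>\<^sub>F n in sequentially. 1 \<le> (n :: nat)" by (rule eventually_ge_at_top)
  ultimately have "\<forall>\<^sub>F n in sequentially. 1 \<le> j n \<and> (\<exists>k\<ge>j n. 2 * real k *
    (\<Prod>l\<in>{k-j n..<k}. ((real n + 2 * real l) / real n) ^ Suc m / (2 * real (Suc l) / real n)) \<le>
    y ^ j n / (real n)\<^sup>2)"
  proof eventually_elim
    case (elim n)
    define K where "K = n div (2 * m)"
    have n: "0 < real n" using elim by simp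
    have j1: "real (j n) \<le> sqrt (real n)" "sqrt (real n) - 1 < real (j n)"
      using n by (auto simp: j_def)
    have "1 \<le> sqrt (real n)" using elim by simp
    then have "1 \<le> j n" unfolding j_def by (simp add: le_nat_floor)
    have K: "real K \<le> real n / (2 * real m)" "real n / (2 * real m) < real K + 1"
    proof -
      have "K * (2 * m) \<le> n" unfolding K_def by simp
      then have "real K * (2 * real m) \<le> real n" unfolding of_nat_le_iff[symmetric, where 'a = real] by simp
      then show "real K \<le> real n / (2 * real m)" using m by (simp add: pos_le_divide_eq)
      have "n < 2 * m + K * (2 * m)" unfolding K_def using m by (intro dividend_less_div_times) simp
      then have "real n < 2 * real m + real K * (2 * real m)"
        unfolding of_nat_less_iff[symmetric, where 'a = real] by simp
      then show "real n / (2 * real m) < real K + 1" using m by (simp add: pos_divide_less_eq algebra_simps)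
    qed
    have "j n \<le> K"
      using j1 K elim by linarith
    have fac: "((real n + 2 * real l) / real n) ^ Suc m / (2 * real (Suc l) / real n) \<le> y'"
      if l: "l \<in> {K - j n..<K}" for l
    proof -
      \<comment> \<open>Chosen to be the denominator exactly; the numerator has \<open>l\<close> in
        place of \<open>Suc l\<close> and is therefore at most
        \<open>(1 + \<beta>)^(m+1)\<close>.\<close>
      define \<beta> where "\<beta> = 2 * real (Suc l) / real n"
      have \<beta>0: "0 < \<beta>" using n by (simp add: \<beta>_def)
      have "real (Suc l) \<le> real K" using l by simp
      then have "real (Suc l) \<le> real n / (2 * real m)" using K by linarith
      then have up: "\<beta> \<le> 1 / real m" using n m by (simp add: \<beta>_def field_simps)
      have "real K - real (j n) \<le> real l" using l \<open>j n \<le> K\<close> by auto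
      then have "real n / (2 * real m) - 1 - sqrt (real n) \<le> real (Suc l)" using K j1 by linarith
      then have "2 * (real n / (2 * real m) - 1 - sqrt (real n)) / real n \<le> \<beta>"
        unfolding \<beta>_def using n by (intro divide_right_mono mult_left_mono) auto
      moreover have "2 * (real n / (2 * real m) - 1 - sqrt (real n)) / real n =
          1 / real m - (2 / real n + 2 * sqrt (real n) / real n)"
        using n m by (simp add: field_simps)
      ultimately have "dist \<beta> (1 / real m) < d" using up elim(2) by (simp add: dist_real_def)
      then have "h \<beta> < y'" by (rule hd)
      moreover have "((real n + 2 * real l) / real n) ^ Suc m / \<beta> \<le> h \<beta>"
        unfolding h_def Suc_eq_plus1 using n \<beta>0
        by (intro divide_right_mono power_mono) (auto simp: \<beta>_def field_simps)
      ultimately show ?thesis by (simp add: \<beta>_def)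
    qed
    have "(\<Prod>l\<in>{K-j n..<K}. ((real n + 2 * real l) / real n) ^ Suc m / (2 * real (Suc l) / real n)) \<le>
        (\<Prod>l\<in>{K-j n..<K}. y')"
      using n by (intro prod_mono conjI fac) auto
    also have "\<dots> = y' ^ j n" using \<open>j n \<le> K\<close> by simp
    also have "y' ^ j n = \<rho> ^ j n * y ^ j n"
      using y' \<open>0 < y'\<close> by (simp add: \<rho>_def power_divide)
    also have "\<rho> ^ j n = \<rho> powr real (j n)" using \<rho> by (simp add: powr_realpow)
    also have "\<rho> powr real (j n) * y ^ j n \<le> \<rho> powr (sqrt (real n) - 1) * y ^ j n"
      using \<rho> j1 y' \<open>0 < y'\<close> by (intro mult_right_mono powr_mono') auto
    finally have prod: "(\<Prod>l\<in>{K-j n..<K}. ((real n + 2 * real l) / real n) ^ Suc m / (2 * real (Suc l) / real n)) \<le>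
        \<rho> powr (sqrt (real n) - 1) * y ^ j n" .
    have "2 * real K \<le> real n"
    proof -
      have "real n / (2 * real m) \<le> real n / 2" using m n by (intro divide_left_mono) auto
      then show ?thesis using K by linarith
    qed
    then have "2 * real K * (\<Prod>l\<in>{K-j n..<K}. ((real n + 2 * real l) / real n) ^ Suc m / (2 * real (Suc l) / real n)) \<le>
        real n * (\<rho> powr (sqrt (real n) - 1) * y ^ j n)"
      using prod n by (intro mult_mono prod_nonneg) auto
    also have "\<dots> = (real n * \<rho> powr (sqrt (real n) - 1)) * y ^ j n" by simp
    also have "\<dots> \<le> 1 / (real n)\<^sup>2 * y ^ j n"
      using elim(1) y' \<open>0 < y'\<close> by (intro mult_right_mono) auto
    finally show ?case using \<open>1 \<le> j n\<close> \<open>j n \<le> K\<close> by auto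
  qed
  then show ?thesis by blast
qed

text \<open>The bound is computed in the reference model with \<open>m + 1\<close> matrices. The
  trace involves only the first \<open>m\<close> of them, so it has the same expectation in any
  model.\<close>

theorem trace_moment_upper:
  assumes m: "1 \<le> m" and y: "u_limit m < y"
  shows "\<exists>j. \<forall>\<^sub>F n in sequentially. 1 \<le> j n \<and>
    (\<forall>(M :: 'w measure) X. gauss_mats M X n {1..m} \<longrightarrow>
      gauss_family.EE M X (trw n (wpow (gram m) (j n))) \<le> y ^ j n / (real n)\<^sup>2)"
proof -
  obtain j where j: "\<forall>\<^sub>F n in sequentially. 1 \<le> j n \<and> (\<exists>k\<ge>j n. 2 * real k *
    (\<Prod>l\<in>{k-j n..<k}. ((real n + 2 * real l) / real n) ^ Suc m / (2 * real (Suc l) / real n)) \<le>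
    y ^ j n / (real n)\<^sup>2)"
    using upper_bound_asymp[OF m y] by blast
  have "\<forall>\<^sub>F n in sequentially. 1 \<le> j n \<and>
    (\<forall>(M :: 'w measure) X. gauss_mats M X n {1..m} \<longrightarrow>
      gauss_family.EE M X (trw n (wpow (gram m) (j n))) \<le> y ^ j n / (real n)\<^sup>2)"
    using j
  proof eventually_elim
    case (elim n)
    then obtain k where k: "j n \<le> k" "2 * real k *
      (\<Prod>l\<in>{k-j n..<k}. ((real n + 2 * real l) / real n) ^ Suc m / (2 * real (Suc l) / real n)) \<le>
      y ^ j n / (real n)\<^sup>2" by blast
    have "gauss_family.EE M X (trw n (wpow (gram m) (j n))) \<le> y ^ j n / (real n)\<^sup>2"
      if "gauss_mats M X n {1..m}" for M :: "'w measure" and X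
    proof -
      interpret gauss_mats M X n "{1..m}" by fact
      interpret A: gauss_mats "ginibre n {1..Suc m}" "\<lambda>v x. x v" n "{1..Suc m}"
        using n_pos by (intro gauss_mats_ginibre) auto
      have "EE (trw n (wpow (gram m) (j n))) = A.EE (trw n (wpow (gram m) (j n)))"
        by (rule EE_eqI[OF gauss_family_axioms A.gauss_family_axioms pos_poly_trw])
          (use idx_wpow[of "gram m" "j n"] in \<open>auto simp: idx_gram vars_def\<close>)
      also have "\<dots> \<le> y ^ j n / (real n)\<^sup>2"
        using A.EE_trace_gram_power_le[OF subset_refl, of "j n" k] elim k by simp
      finally show ?thesis .
    qed
    with elim show ?case by blast
  qed
  then show ?thesis by blast
qed

section \<open>Singular values and almost sure convergence\<close>

definition tr_mat :: "'a :: comm_ring_1 mat \<Rightarrow> 'a" where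
  "tr_mat A = (\<Sum>i<dim_row A. A $$ (i, i))"

lemma tr_mat_mult_commute:
  assumes "A \<in> carrier_mat n n" "B \<in> carrier_mat n n"
  shows "tr_mat (A * B) = tr_mat (B * A)"
proof -
  have "tr_mat (A * B) = (\<Sum>i<n. \<Sum>k<n. A $$ (i, k) * B $$ (k, i))"
    using assms by (auto simp: tr_mat_def scalar_prod_def lessThan_atLeast0 intro!: sum.cong)
  also have "\<dots> = (\<Sum>k<n. \<Sum>i<n. A $$ (i, k) * B $$ (k, i))"
    by (rule sum.swap)
  also have "\<dots> = tr_mat (B * A)"
    using assms by (auto simp: tr_mat_def scalar_prod_def lessThan_atLeast0 mult.commute intro!: sum.cong)
  finally show ?thesis .
qed

lemma upper_triangular_pow:
  fixes B :: "'a :: comm_ring_1 mat"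
  assumes B: "B \<in> carrier_mat n n" "upper_triangular B"
  shows "upper_triangular (B ^\<^sub>m k) \<and> (\<forall>i<n. (B ^\<^sub>m k) $$ (i, i) = (B $$ (i, i)) ^ k)"
proof (induction k)
  case 0
  then show ?case using B by simp
next
  case (Suc k)
  let ?C = "B ^\<^sub>m k"
  have C: "?C \<in> carrier_mat n n" using B by simp
  have CB: "(?C * B) $$ (i, j) = (\<Sum>l<n. ?C $$ (i, l) * B $$ (l, j))" if "i < n" "j < n" for i j
    using B C that by (auto simp: scalar_prod_def lessThan_atLeast0 intro!: sum.cong)
  have low: "?C $$ (i, l) = 0" "B $$ (i, l) = 0" if "l < i" "i < n" for i l
    using Suc B C that by auto
  have "(?C * B) $$ (i, j) = 0" if "j < i" "i < n" for i j
    unfolding CB[OF that(2) less_trans[OF that]]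
  proof (intro sum.neutral ballI)
    fix l assume "l \<in> {..<n}"
    then show "?C $$ (i, l) * B $$ (l, j) = 0" using low[of l i] low[of j l] that by (cases "l < i") auto
  qed
  moreover have "(?C * B) $$ (i, i) = (B $$ (i, i)) ^ Suc k" if "i < n" for i
  proof -
    have "(?C * B) $$ (i, i) = (\<Sum>l<n. if l = i then ?C $$ (i, i) * B $$ (i, i) else 0)"
      unfolding CB[OF that that]
    proof (intro sum.cong refl)
      fix l assume "l \<in> {..<n}"
      then show "?C $$ (i, l) * B $$ (l, i) = (if l = i then ?C $$ (i, i) * B $$ (i, i) else 0)"
        using low[of l i] low[of i l] that by (cases l i rule: linorder_cases) auto
    qed
    then show ?thesis using Suc that by (simp add: mult.commute)
  qed
  ultimately show ?case using B C by (auto intro!: upper_triangularI)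
qed

text \<open>In a Schur decomposition the triangular factor has the eigenvalues on its diagonal,
  powers act on this diagonal entrywise, and the trace is invariant under similarity.\<close>

lemma tr_mat_pow_eigenvalues:
  fixes A :: "'a :: conjugatable_ordered_field mat"
  assumes A: "A \<in> carrier_mat n n" and cp: "char_poly A = (\<Prod>e\<leftarrow>es. [:- e, 1:])"
  shows "tr_mat (A ^\<^sub>m k) = (\<Sum>e\<leftarrow>es. e ^ k)"
proof -
  obtain B P Q where "schur_decomposition A es = (B, P, Q)" by (cases "schur_decomposition A es")
  from schur_decomposition[OF A cp this]
  have sim: "similar_mat_wit A B P Q" and B: "upper_triangular B" "diag_mat B = es" by auto
  note carr = similar_mat_witD2[OF A sim]
  have Bk: "B ^\<^sub>m k \<in> carrier_mat n n" using carr by simp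
  have "tr_mat (A ^\<^sub>m k) = tr_mat (P * (B ^\<^sub>m k * Q))"
    using similar_mat_wit_pow_id[OF sim, of k] carr Bk by (simp add: assoc_mult_mat[of _ n n _ n _ n])
  also have "\<dots> = tr_mat (B ^\<^sub>m k * Q * P)"
    using carr Bk by (intro tr_mat_mult_commute[of _ n]) auto
  also have "B ^\<^sub>m k * Q * P = B ^\<^sub>m k"
    using carr Bk by (simp add: assoc_mult_mat[of _ n n _ n _ n])
  also have "tr_mat (B ^\<^sub>m k) = (\<Sum>i<n. (B $$ (i, i)) ^ k)"
    using upper_triangular_pow[of B n k] carr B by (simp add: tr_mat_def)
  also have "\<dots> = (\<Sum>e\<leftarrow>diag_mat B. e ^ k)"
    using carr by (simp add: diag_mat_def comp_def interv_sum_list_conv_sum_set_nat atLeast0LessThan)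
  finally show ?thesis by (simp add: B)
qed

text \<open>With \<open>Q\<close> the complexified \<open>P\<close> and \<open>v\<close> an
  eigenvector, the squared norm of \<open>Q v\<close> is \<open>e\<close> times that of
  \<open>v\<close>. So \<open>e\<close> is a nonnegative real divided by a positive one.\<close>

lemma eigenvalue_gram_nonneg:
  fixes P :: "real mat"
  assumes P: "P \<in> carrier_mat n n"
    and ev: "eigenvalue (map_mat complex_of_real (P\<^sup>T * P)) e"
  shows "\<exists>r\<ge>0. e = complex_of_real r"
proof -
  define Q where "Q = map_mat complex_of_real P"
  have Q: "Q \<in> carrier_mat n n" using P by (simp add: Q_def)
  have gram: "map_mat complex_of_real (P\<^sup>T * P) = Q\<^sup>T * Q"
    unfolding Q_def using P
    by (subst of_real_hom.mat_hom_mult[of _ n n _ n]) (auto simp: map_mat_transpose)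
  obtain v where v: "v \<in> carrier_vec n" "v \<noteq> 0\<^sub>v n" "(Q\<^sup>T * Q) *\<^sub>v v = e \<cdot>\<^sub>v v"
    using ev Q unfolding gram eigenvalue_def eigenvector_def by auto
  have conj: "conjugate (Q *\<^sub>v v) = Q *\<^sub>v conjugate v"
  proof (rule eq_vecI)
    fix i assume "i < dim_vec (Q *\<^sub>v conjugate v)"
    then have i: "i < n" using Q by simp
    have "conjugate (Q *\<^sub>v v) $ i = cnj (\<Sum>k<n. Q $$ (i, k) * v $ k)"
      using Q v i by (simp add: scalar_prod_def lessThan_atLeast0)
    also have "\<dots> = (\<Sum>k<n. Q $$ (i, k) * cnj (v $ k))"
      using P i by (auto simp: Q_def intro!: sum.cong)
    finally show "conjugate (Q *\<^sub>v v) $ i = (Q *\<^sub>v conjugate v) $ i"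
      using Q v i by (simp add: scalar_prod_def lessThan_atLeast0)
  qed (use Q in auto)
  have "(Q *\<^sub>v v) \<bullet>c (Q *\<^sub>v v) = (Q *\<^sub>v v) \<bullet> (Q *\<^sub>v conjugate v)" by (simp add: conj)
  also have "\<dots> = (Q\<^sup>T *\<^sub>v (Q *\<^sub>v v)) \<bullet> conjugate v"
  proof -
    have w: "Q *\<^sub>v v \<in> carrier_vec n" using Q v by simp
    have "(Q *\<^sub>v v) \<bullet> (Q *\<^sub>v conjugate v) = (\<Sum>i<n. \<Sum>k<n. (Q *\<^sub>v v) $ i * (Q $$ (i, k) * cnj (v $ k)))"
      using Q v by (simp add: scalar_prod_def lessThan_atLeast0 sum_distrib_left)
    also have "\<dots> = (\<Sum>k<n. \<Sum>i<n. (Q *\<^sub>v v) $ i * (Q $$ (i, k) * cnj (v $ k)))"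
      by (rule sum.swap)
    also have "\<dots> = (\<Sum>k<n. (\<Sum>i<n. Q\<^sup>T $$ (k, i) * (Q *\<^sub>v v) $ i) * cnj (v $ k))"
      using Q by (auto simp: sum_distrib_left mult_ac intro!: sum.cong)
    also have "\<dots> = (Q\<^sup>T *\<^sub>v (Q *\<^sub>v v)) \<bullet> conjugate v"
      using Q v(1) w by (simp add: scalar_prod_def lessThan_atLeast0)
    finally show ?thesis .
  qed
  also have "Q\<^sup>T *\<^sub>v (Q *\<^sub>v v) = e \<cdot>\<^sub>v v"
    using v(3) Q v(1) by (simp add: assoc_mult_mat_vec[of _ n n _ n])
  also have "(e \<cdot>\<^sub>v v) \<bullet> conjugate v = e * (v \<bullet>c v)"
    using v(1) by simp
  finally have eq: "(Q *\<^sub>v v) \<bullet>c (Q *\<^sub>v v) = e * (v \<bullet>c v)" .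
  have pos: "0 < v \<bullet>c v" using v conjugate_square_greater_0_vec[of v n] by simp
  have "0 \<le> (Q *\<^sub>v v) \<bullet>c (Q *\<^sub>v v)" using Q v by (intro conjugate_square_ge_0_vec)
  then obtain p q where p: "(Q *\<^sub>v v) \<bullet>c (Q *\<^sub>v v) = complex_of_real p" "0 \<le> p"
    and q: "v \<bullet>c v = complex_of_real q" "0 < q"
    using pos by (auto simp: less_eq_complex_def less_complex_def complex_eq_iff)
  then have "e = complex_of_real (p / q)" using eq by (simp add: field_simps)
  then show ?thesis using p q by (intro exI[of _ "p / q"]) auto
qed

text \<open>The polynomial splits over the complex numbers and its roots there are real and
  nonnegative; injectivity of the coefficient embedding brings the factorization back to the
  reals.\<close>

lemma char_poly_gram:
  fixes P :: "real mat"
  assumes P: "P \<in> carrier_mat n n"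
  obtains rs where "length rs = n" "\<And>r. r \<in> set rs \<Longrightarrow> 0 \<le> r"
    "char_poly (P\<^sup>T * P) = (\<Prod>r\<leftarrow>rs. [:- r, 1:])"
proof -
  define A where "A = P\<^sup>T * P"
  have A: "A \<in> carrier_mat n n" using P by (simp add: A_def)
  define Ac where "Ac = map_mat complex_of_real A"
  have Ac: "Ac \<in> carrier_mat n n" using A by (simp add: Ac_def)
  obtain es where es: "char_poly Ac = (\<Prod>e\<leftarrow>es. [:- e, 1:])" "length es = n"
    using char_poly_factorized[OF Ac] by blast
  have ev: "\<exists>r\<ge>0. e = complex_of_real r" if "e \<in> set es" for e
  proof (rule eigenvalue_gram_nonneg[OF P])
    have "poly (char_poly Ac) e = 0"
      unfolding es poly_prod_list prod_list_zero_iff using that by force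
    then show "eigenvalue (map_mat complex_of_real (P\<^sup>T * P)) e"
      using eigenvalue_root_char_poly[OF Ac] by (simp add: Ac_def A_def)
  qed
  define rs where "rs = map Re es"
  have es_rs: "es = map complex_of_real rs"
    unfolding rs_def map_map by (rule map_idI[symmetric]) (use ev in force)
  interpret hom: map_poly_inj_comm_ring_hom complex_of_real ..
  have "map_poly complex_of_real (char_poly A) = map_poly complex_of_real (\<Prod>r\<leftarrow>rs. [:- r, 1:])"
  proof -
    have "map_poly complex_of_real (char_poly A) = (\<Prod>e\<leftarrow>es. [:- e, 1:])"
      unfolding es(1)[symmetric] Ac_def by (rule of_real_hom.char_poly_hom[OF A, symmetric])
    also have "\<dots> = map_poly complex_of_real (\<Prod>r\<leftarrow>rs. [:- r, 1:])"
      unfolding es_rs hom.hom_prod_list by (simp add: comp_def)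
    finally show ?thesis .
  qed
  then have "char_poly A = (\<Prod>r\<leftarrow>rs. [:- r, 1:])" by (simp only: hom.eq_iff)
  moreover have "0 \<le> r" if "r \<in> set rs" for r
    using that ev by (force simp: rs_def)
  moreover have "length rs = n" using es by (simp add: rs_def)
  ultimately show ?thesis using that by (simp add: A_def)
qed

lemma singular_value_trace_bounds:
  fixes P :: "real mat"
  assumes P: "P \<in> carrier_mat n n" and n: "1 \<le> n"
  shows "((singular_value 1 P)\<^sup>2) ^ j \<le> tr_mat ((P\<^sup>T * P) ^\<^sub>m j)"
    "tr_mat ((P\<^sup>T * P) ^\<^sub>m j) \<le> real n * ((singular_value 1 P)\<^sup>2) ^ j"
proof -
  obtain rs where rs: "length rs = n" "\<And>r. r \<in> set rs \<Longrightarrow> 0 \<le> r"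
    "char_poly (P\<^sup>T * P) = (\<Prod>r\<leftarrow>rs. [:- r, 1:])"
    using char_poly_gram[OF P] by metis
  have tr: "tr_mat ((P\<^sup>T * P) ^\<^sub>m j) = (\<Sum>r\<leftarrow>rs. r ^ j)"
    using P by (intro tr_mat_pow_eigenvalues[OF _ rs(3), of n]) auto
  have "proots (\<Prod>r\<leftarrow>rs'. [:- r, 1:]) = mset rs'" for rs' :: "real list"
  proof (induction rs')
    case (Cons r rs')
    have "(\<Prod>r\<leftarrow>rs'. [:- r, 1:]) \<noteq> 0" by (auto simp: prod_list_zero_iff)
    then have "proots ([:- r, 1:] * (\<Prod>r\<leftarrow>rs'. [:- r, 1:])) = {#r#} + mset rs'"
      using Cons proots_linear_factor[of "- r"] by (subst proots_mult) simp_all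
    then show ?case by (simp del: mult_pCons_left)
  qed simp
  then have roots: "proots (char_poly (P\<^sup>T * P)) = mset rs" using rs(3) by simp
  define L where "L = sorted_list_of_multiset (image_mset sqrt (mset rs))"
  have sv: "singular_values P = rev L"
    by (simp add: singular_values_def L_def roots)
  have setL: "set L = sqrt ` set rs" by (simp add: L_def)
  have "L \<noteq> []" using setL rs(1) n by auto
  \<comment> \<open>Index 0 of the reversed list is the last entry of the ascending one, the root of
    the largest eigenvalue.\<close>
  then have s: "singular_value 1 P = last L"
    by (simp add: singular_value_def sv rev_nth last_conv_nth)
  have "sorted L" by (simp add: L_def)
  then have max: "x \<le> last L" if x: "x \<in> set L" for x
  proof -
    obtain i where i: "i < length L" "x = L ! i" using x by (auto simp: in_set_conv_nth)
    then have "L ! i \<le> L ! (length L - 1)" using \<open>sorted L\<close> by (intro sorted_nth_mono) auto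
    then show ?thesis using i \<open>L \<noteq> []\<close> by (simp add: last_conv_nth)
  qed
  obtain r0 where r0: "r0 \<in> set rs" "last L = sqrt r0"
    using last_in_set[OF \<open>L \<noteq> []\<close>] setL by auto
  have s2: "(singular_value 1 P)\<^sup>2 = r0" unfolding s using r0 rs(2) by simp
  have le: "r \<le> r0" if "r \<in> set rs" for r
    using max[of "sqrt r"] that setL r0 by auto
  have "r0 ^ j \<le> (\<Sum>r\<leftarrow>rs. r ^ j)"
    using r0(1) rs(2) by (intro member_le_sum_list) (auto intro: rev_image_eqI)
  then show "((singular_value 1 P)\<^sup>2) ^ j \<le> tr_mat ((P\<^sup>T * P) ^\<^sub>m j)" by (simp only: s2 tr)
  have "(\<Sum>r\<leftarrow>rs. r ^ j) \<le> real (length rs) * r0 ^ j"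
    using le rs(2) by (intro sum_list_le_length_mult power_mono) auto
  then show "tr_mat ((P\<^sup>T * P) ^\<^sub>m j) \<le> real n * ((singular_value 1 P)\<^sup>2) ^ j" by (simp only: s2 tr rs(1))
qed

section \<open>Words evaluated as matrices\<close>

definition word_mat :: "nat \<Rightarrow> (nat \<times> nat \<times> nat \<Rightarrow> real) \<Rightarrow> letter list \<Rightarrow> real mat" where
  "word_mat n x w = mat n n (\<lambda>(a, b). ent n w a b x)"

lemma word_mat_carrier [simp]: "word_mat n x w \<in> carrier_mat n n"
  by (simp add: word_mat_def)

lemma word_mat_append: "word_mat n x (u @ w) = word_mat n x u * word_mat n x w"
  by (rule eq_matI) (auto simp: word_mat_def ent_append scalar_prod_def lessThan_atLeast0)

lemma word_mat_flip: "word_mat n x (flip w) = (word_mat n x w)\<^sup>T"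
  by (rule eq_matI) (auto simp: word_mat_def ent_flip)

lemma word_mat_Nil: "word_mat n x [] = 1\<^sub>m n"
  by (rule eq_matI) (auto simp: word_mat_def)

lemma word_mat_wpow: "word_mat n x (wpow w k) = word_mat n x w ^\<^sub>m k"
  by (induction k) (simp_all add: word_mat_Nil wpow_Suc' word_mat_append word_mat_def[of n x w] del: wpow_simps(2))

lemma trw_eq_tr_mat: "trw n w x = tr_mat (word_mat n x w)"
  by (simp add: trw_def tr_mat_def word_mat_def)

lemma word_mat_fwd:
  assumes Y: "\<And>k. k \<in> {1..m} \<Longrightarrow> Y k \<in> carrier_mat n n"
    and x: "\<And>k a b. x (k, a, b) = Y k $$ (a, b)"
  shows "word_mat n x (fwd 0 m) = mat_product n m Y"
proof -
  have "word_mat n x (map (\<lambda>k. (k, False)) ks) = foldr (\<lambda>k P. Y k * P) ks (1\<^sub>m n)"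
    if "set ks \<subseteq> {1..m}" for ks
    using that
  proof (induction ks)
    case Nil
    then show ?case by (simp add: word_mat_Nil)
  next
    case (Cons k ks)
    have "word_mat n x (map (\<lambda>k. (k, False)) (k # ks)) = Y k * word_mat n x (map (\<lambda>k. (k, False)) ks)"
      using Y[of k] Cons.prems
      by (intro eq_matI) (auto simp: word_mat_def lvar_def x scalar_prod_def lessThan_atLeast0)
    then show ?case using Cons by simp
  qed
  from this[of "[1..<Suc m]"] show ?thesis
    by (simp add: fwd_def mat_product_def atLeastLessThanSuc_atLeastAtMost del: upt_Suc)
qed

section \<open>Almost sure convergence\<close>

lemma (in prob_space) borel_cantelli_AE_inverse_square:
  assumes meas: "\<And>n. A n \<in> events"
    and le: "\<forall>\<^sub>F n in sequentially. prob (A n) \<le> C / (real n)\<^sup>2"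
  shows "AE \<omega> in M. \<forall>\<^sub>F n in sequentially. \<omega> \<notin> A n"
proof -
  \<comment> \<open>The first Borel-Cantelli lemma works from the individual probabilities alone,
    which fits matrices of different sizes with an arbitrary joint law.\<close>
  have "summable (\<lambda>n. prob (A n))"
  proof (rule summable_comparison_test_ev)
    show "\<forall>\<^sub>F n in sequentially. norm (prob (A n)) \<le> C * (1 / (real n)\<^sup>2)"
      using le by eventually_elim simp
    have "summable (\<lambda>n. inverse ((real n)\<^sup>2))" by (rule inverse_power_summable) simp
    then show "summable (\<lambda>n. C * (1 / (real n)\<^sup>2))"
      by (intro summable_mult) (simp add: inverse_eq_divide)
  qed
  then have "AE \<omega> in M. \<forall>\<^sub>F n in sequentially. \<omega> \<in> space M - A n"
    using meas by (intro borel_cantelli_AE1) (auto simp: emeasure_eq_measure)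
  then show ?thesis by eventually_elim (auto elim: eventually_mono)
qed

theorem mainTheorem1:
  fixes M :: "'w measure"
    and m :: nat
    and W :: "nat \<Rightarrow> nat \<Rightarrow> 'w \<Rightarrow> real mat"
  assumes "prob_space M"
    and "m \<ge> 1"
    and "\<And>n. n \<ge> 1 \<Longrightarrow> prob_space.indep_vars M (\<lambda>_. borel_mat n) (W n) {1..m}"
    and "\<And>n k. n \<ge> 1 \<Longrightarrow> k \<in> {1..m} \<Longrightarrow> iid_gaussian_mat M n (1 / sqrt (real n)) (W n k)"
  shows "AE \<omega> in M.
    (\<lambda>n. (singular_value 1 (mat_product n m (\<lambda>k. W n k \<omega>)))\<^sup>2) \<longlonglongrightarrow> u_limit m"
proof -
  interpret prob_space M by fact
  define X where "X n = (\<lambda>(r, a, b) \<omega>. W n r \<omega> $$ (a, b))" for n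
  define S where "S n \<omega> = (singular_value 1 (mat_product n m (\<lambda>k. W n k \<omega>)))\<^sup>2" for n \<omega>
  define T where "T n j \<omega> = trw n (wpow (gram m) j) (\<lambda>v. X n v \<omega>)" for n j \<omega>
  have gm: "gauss_mats M (X n) n {1..m}" if "1 \<le> n" for n
    unfolding X_def using that assms by (intro gauss_mats_iid) auto
  have EE: "gauss_family.EE M (X n) (trw n (wpow (gram m) j)) = expectation (T n j)" if "1 \<le> n" for n j
  proof -
    interpret G: gauss_mats M "X n" n "{1..m}" by (rule gm[OF that])
    show ?thesis by (simp add: G.EE_def T_def[abs_def])
  qed
  have sub: "idx (wpow (gram m) j) \<subseteq> {1..m}" for j
    using idx_wpow[of "gram m" j] by (simp add: idx_gram)
  have intT: "integrable M (T n j)" if "1 \<le> n" for n j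
  proof -
    interpret G: gauss_mats M "X n" n "{1..m}" by (rule gm[OF that])
    show ?thesis unfolding T_def[abs_def] by (rule G.integrable_pos_poly[OF pos_poly_trw[OF sub]])
  qed
  have bounds: "S n \<omega> ^ j \<le> T n j \<omega>" "T n j \<omega> \<le> real n * S n \<omega> ^ j" if "1 \<le> n" "\<omega> \<in> space M" for n j \<omega>
  proof -
    have carr: "W n k \<omega> \<in> carrier_mat n n" if "k \<in> {1..m}" for k
    proof -
      have "W n k \<in> measurable M (borel_mat n)"
        using assms(4)[OF \<open>1 \<le> n\<close> that] by (simp add: iid_gaussian_mat_def)
      from measurable_space[OF this \<open>\<omega> \<in> space M\<close>] show ?thesis by (simp add: borel_mat_def)
    qed
    define P where "P = mat_product n m (\<lambda>k. W n k \<omega>)"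
    have "word_mat n (\<lambda>v. X n v \<omega>) (fwd 0 m) = P"
      unfolding P_def by (rule word_mat_fwd) (auto simp: carr X_def)
    then have "P \<in> carrier_mat n n" "T n j \<omega> = tr_mat ((P\<^sup>T * P) ^\<^sub>m j)"
      by (auto simp: T_def trw_eq_tr_mat word_mat_wpow gram_def word_mat_append word_mat_flip)
    then show "S n \<omega> ^ j \<le> T n j \<omega>" "T n j \<omega> \<le> real n * S n \<omega> ^ j"
      unfolding S_def P_def[symmetric] using singular_value_trace_bounds \<open>1 \<le> n\<close> by auto
  qed
  have S_nonneg: "0 \<le> S n \<omega>" for n \<omega> by (simp add: S_def)
  have upper: "AE \<omega> in M. \<forall>\<^sub>F n in sequentially. S n \<omega> < y" if y: "u_limit m < y" for y
  proof -
    have "0 < y" using u_limit_pos[OF \<open>m \<ge> 1\<close>] y by simp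
    obtain j where j: "\<forall>\<^sub>F n in sequentially. 1 \<le> j n \<and>
      (\<forall>(M :: 'w measure) X. gauss_mats M X n {1..m} \<longrightarrow>
        gauss_family.EE M X (trw n (wpow (gram m) (j n))) \<le> y ^ j n / (real n)\<^sup>2)"
      using trace_moment_upper[OF \<open>m \<ge> 1\<close> y] by blast
    \<comment> \<open>The exceptional event, set to be empty at \<open>n = 0\<close>, where the
      matrices are not assumed Gaussian or measurable.\<close>
    define A where "A n = (if 1 \<le> n then {\<omega> \<in> space M. y ^ j n \<le> T n (j n) \<omega>} else {})" for n
    have "A n \<in> events" for n
      using intT[of n "j n"] by (auto simp: A_def intro!: borel_measurable_le)
    moreover have "\<forall>\<^sub>F n in sequentially. prob (A n) \<le> 1 / (real n)\<^sup>2"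
      using j eventually_ge_at_top[of 1]
    proof eventually_elim
      case (elim n)
      then have "expectation (T n (j n)) \<le> y ^ j n / (real n)\<^sup>2"
        using gm[of n] EE[of n "j n"] by metis
      have "0 \<le> T n (j n) \<omega>" if "\<omega> \<in> space M" for \<omega>
        using bounds(1)[OF elim(2) that, of "j n"] S_nonneg[of n \<omega>] by (meson order_trans zero_le_power)
      \<comment> \<open>Markov's inequality at the threshold \<open>y ^ j n\<close>; the moment
        bound has a factor \<open>1 / n^2\<close> to spare, which gives summability.\<close>
      then have "prob (A n) \<le> expectation (T n (j n)) / y ^ j n"
        using elim(2) \<open>0 < y\<close> intT[of n "j n"] unfolding A_def
        by (auto intro!: integral_Markov_inequality_measure[where A = "space M"])
      also have "\<dots> \<le> (y ^ j n / (real n)\<^sup>2) / y ^ j n"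
        using \<open>expectation _ \<le> _\<close> \<open>0 < y\<close> by (intro divide_right_mono) auto
      finally show ?case using \<open>0 < y\<close> by simp
    qed
    ultimately have "AE \<omega> in M. \<forall>\<^sub>F n in sequentially. \<omega> \<notin> A n"
      by (rule borel_cantelli_AE_inverse_square)
    then show ?thesis
    proof (rule AE_mp, intro AE_I2 impI)
      fix \<omega> assume \<omega>: "\<omega> \<in> space M" "\<forall>\<^sub>F n in sequentially. \<omega> \<notin> A n"
      from \<omega>(2) eventually_ge_at_top[of 1] show "\<forall>\<^sub>F n in sequentially. S n \<omega> < y"
      proof eventually_elim
        case (elim n)
        then have "S n \<omega> ^ j n < y ^ j n"
          using \<omega>(1) bounds(1)[of n \<omega> "j n"] by (simp add: A_def)
        then show ?case using \<open>0 < y\<close> by (metis power_less_imp_less_base less_imp_le)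
      qed
    qed
  qed
  have lower: "AE \<omega> in M. \<forall>\<^sub>F n in sequentially. y < S n \<omega>" if y: "0 < y" "y < u_limit m" for y
  proof -
    obtain i a where i: "1 \<le> i" "y ^ i < a" "\<And>(M :: 'w measure) X n. gauss_mats M X n {1..m} \<Longrightarrow>
      real n * a \<le> gauss_family.EE M X (trw n (wpow (gram m) i))"
      using trace_moment_lower[OF \<open>m \<ge> 1\<close> y] by blast
    define A where "A n = (if 1 \<le> n then {\<omega> \<in> space M. T n i \<omega> \<le> real n * y ^ i} else {})" for n
    \<comment> \<open>The sum dominates the variance bound for the word in question and does not
      depend on \<open>n\<close>.\<close>
    define C where "C = (\<Sum>L\<le>2 * length (wpow (gram m) i). real L * fact L) / (a - y ^ i)\<^sup>2"
    have "A n \<in> events" for n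
      using intT[of n i] by (auto simp: A_def intro!: borel_measurable_le)
    moreover have "\<forall>\<^sub>F n in sequentially. prob (A n) \<le> C / (real n)\<^sup>2"
      using eventually_ge_at_top[of 1]
    proof eventually_elim
      case (elim n)
      interpret G: gauss_mats M "X n" n "{1..m}" by (rule gm[OF elim])
      define d where "d = real n * (a - y ^ i)"
      have d: "0 < d" using elim i by (simp add: d_def)
      have mean: "real n * a \<le> expectation (T n i)"
        using i(3)[OF gm[OF elim]] EE[OF elim] by simp
      have "integrable M (\<lambda>\<omega>. T n i \<omega> * T n i \<omega>)"
        unfolding T_def by (rule G.integrable_pos_poly) (intro pos_poly.mult pos_poly_trw sub)
      then have int2: "integrable M (\<lambda>\<omega>. (T n i \<omega>)\<^sup>2)" by (simp add: power2_eq_square)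
      have "expectation (\<lambda>\<omega>. (T n i \<omega>)\<^sup>2) \<le> (expectation (T n i))\<^sup>2 + G.cov_bound (2 * length (wpow (gram m) i))"
        using G.EE_trw_square_le[OF sub, of i] unfolding EE[OF elim]
        by (simp add: G.EE_def T_def[symmetric] power2_eq_square)
      then have var: "variance (T n i) \<le> G.cov_bound (2 * length (wpow (gram m) i))"
        using variance_eq[OF intT[OF elim] int2] by simp
      \<comment> \<open>The mean is at least \<open>n * a\<close>, while on \<open>A n\<close> the
        trace is at most \<open>n * y ^ i\<close>. This deviation of order \<open>n\<close> against
        a bounded variance gives probabilities of order \<open>1 / n^2\<close>.\<close>
      have "A n \<subseteq> {\<omega> \<in> space M. d \<le> \<bar>T n i \<omega> - expectation (T n i)\<bar>}"
        using elim mean by (auto simp: A_def d_def algebra_simps)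
      then have "prob (A n) \<le> prob {\<omega> \<in> space M. d \<le> \<bar>T n i \<omega> - expectation (T n i)\<bar>}"
        using intT[OF elim, of i] by (intro finite_measure_mono) (auto intro!: borel_measurable_le)
      also have "\<dots> \<le> variance (T n i) / d\<^sup>2"
        using intT[OF elim, of i] int2 d by (intro Chebyshev_inequality) auto
      also have "\<dots> \<le> G.cov_bound (2 * length (wpow (gram m) i)) / d\<^sup>2"
        by (intro divide_right_mono var) auto
      also have "G.cov_bound (2 * length (wpow (gram m) i)) \<le> (\<Sum>L\<le>2 * length (wpow (gram m) i). real L * fact L)"
        unfolding G.cov_bound_def by (rule member_le_sum) auto
      finally show ?case by (simp add: C_def d_def power_mult_distrib divide_right_mono mult.commute)
    qed
    ultimately have "AE \<omega> in M. \<forall>\<^sub>F n in sequentially. \<omega> \<notin> A n"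
      by (rule borel_cantelli_AE_inverse_square)
    then show ?thesis
    proof (rule AE_mp, intro AE_I2 impI)
      fix \<omega> assume \<omega>: "\<omega> \<in> space M" "\<forall>\<^sub>F n in sequentially. \<omega> \<notin> A n"
      from \<omega>(2) eventually_ge_at_top[of 1] show "\<forall>\<^sub>F n in sequentially. y < S n \<omega>"
      proof eventually_elim
        case (elim n)
        then have "real n * y ^ i < T n i \<omega>" using \<omega>(1) by (simp add: A_def)
        also have "\<dots> \<le> real n * S n \<omega> ^ i" by (rule bounds(2)[OF elim(2) \<omega>(1)])
        finally have "y ^ i < S n \<omega> ^ i" using elim by simp
        then show ?case using S_nonneg by (metis power_less_imp_less_base)
      qed
    qed
  qed
  \<comment> \<open>Rational thresholds are countable, so one null set serves all of them.\<close>
  have "AE \<omega> in M. \<forall>y\<in>\<rat>. u_limit m < y \<longrightarrow> (\<forall>\<^sub>F n in sequentially. S n \<omega> < y)"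
    by (subst AE_ball_countable[OF countable_rat]) (use upper in auto)
  moreover have "AE \<omega> in M. \<forall>y\<in>\<rat>. 0 < y \<and> y < u_limit m \<longrightarrow> (\<forall>\<^sub>F n in sequentially. y < S n \<omega>)"
    by (subst AE_ball_countable[OF countable_rat]) (use lower in auto)
  ultimately have "AE \<omega> in M. (\<lambda>n. S n \<omega>) \<longlonglongrightarrow> u_limit m"
  proof eventually_elim
    case (elim \<omega>)
    show ?case
    proof (rule order_tendstoI)
      fix z assume "u_limit m < z"
      then obtain y where "y \<in> \<rat>" "u_limit m < y" "y < z" using Rats_dense_in_real by blast
      then show "\<forall>\<^sub>F n in sequentially. S n \<omega> < z"
        using elim(1) by (auto elim!: eventually_mono dest!: bspec[of _ _ y])
    next
      fix z assume "z < u_limit m"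
      \<comment> \<open>The lower estimate is available for positive \<open>y\<close> only, so a
        negative \<open>z\<close> is replaced by 0.\<close>
      then have "max 0 z < u_limit m" using u_limit_pos[OF \<open>m \<ge> 1\<close>] by simp
      then obtain y where "y \<in> \<rat>" "max 0 z < y" "y < u_limit m" using Rats_dense_in_real by blast
      then show "\<forall>\<^sub>F n in sequentially. z < S n \<omega>"
        using elim(2) by (auto elim!: eventually_mono dest!: bspec[of _ _ y])
    qed
  qed
  then show ?thesis by (simp add: S_def)
qed

end
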